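(* Let $P$ be a full-dimensional polytope in $\mathbb{P}^n$ with $d$ facets and a simple hyperplane arrangement $\mathcal{H}_P$. Then the dimension of $\Omega_P:=H^0(\mathbb{P}^n,\mathcal{I}_{\mathcal{R}_P}(d-n))$ equals the number of vertices of $P$.
   Context: $\mathbb{P}^n$ is complex projective $n$-space. A full-dimensional polytope $P$ in $\mathbb{P}^n$ is the collection of the Zariski closures in $\mathbb{P}^n$ of the (nonempty) faces of a full-dimensional convex polytope in an affine chart $\mathbb{R}^n\subset\mathbb{P}^n$. $\mathcal{H}_P$ is the arrangement of hyperplanes spanned by the facets of $P$; it is simple if through any point of $\mathbb{P}^n$ pass at most $n$ hyperplanes of $\mathcal{H}_P$. The residual arrangement $\mathcal{R}_P$ is the union (a reduced subscheme of $\mathbb{P}^n$) of all linear spaces that are intersections of hyperplanes in $\mathcal{H}_P$ and do not contain any face of $P$; $\mathcal{I}_{\mathcal{R}_P}$ is its ideal sheaf. *)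

theory Defs
  imports "HOL-Analysis.Analysis" "HOL-Library.Function_Algebras"
begin

text \<open>
  A point of projective space is a one-dimensional complex subspace of \<open>complex^'i\<close>, so
  \<open>'i proj\<close> has dimension \<open>CARD('i) - 1\<close>, and complex projective \<open>n\<close>-space is
  \<open>'n option proj\<close> with \<open>n = CARD('n)\<close>.
\<close>

typedef (overloaded) 'i proj = "{L :: (complex^'i::finite) set. vec.subspace L \<and> vec.dim L = 1}"
  morphisms line_of Proj
proof -
  have "vec.dim (vec.span {axis undefined 1 :: complex^'i}) = 1"
    by (simp add: vec.dim_span vec.dim_eq_card_independent axis_eq_0_iff)
  then show ?thesis
    using vec.subspace_span by blast
qed

definition proj_point :: "complex^'i \<Rightarrow> 'i::finite proj" where
  "proj_point v = Proj (vec.span {v})"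

definition proj_span :: "'i::finite proj set \<Rightarrow> 'i proj set" where
  "proj_span S = {p. line_of p \<subseteq> vec.span (\<Union>q\<in>S. line_of q)}"

text \<open>The dimension of the linear span; in particular, the dimension of a linear space.\<close>

definition proj_dim :: "'i::finite proj set \<Rightarrow> int" where
  "proj_dim S = int (vec.dim (\<Union>q\<in>S. line_of q)) - 1"


text \<open>Forms of degree \<open>k\<close>, identified with the functions they induce on \<open>complex^'i\<close>.\<close>

definition forms :: "nat \<Rightarrow> (complex^'i::finite \<Rightarrow> complex) set" where
  "forms k = {f. \<exists>c. f = (\<lambda>v. \<Sum>\<alpha> | sum \<alpha> UNIV = k. c \<alpha> * (\<Prod>i\<in>UNIV. (v $ i) ^ \<alpha> i))}"

definition zariski_closed :: "'i::finite proj set \<Rightarrow> bool" where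
  "zariski_closed X \<longleftrightarrow>
    (\<exists>G \<subseteq> (\<Union>k. forms k). X = {p. \<forall>g\<in>G. \<forall>v \<in> line_of p - {0}. g v = 0})"

definition zariski_closure :: "'i::finite proj set \<Rightarrow> 'i proj set" where
  "zariski_closure S = \<Inter>{X. zariski_closed X \<and> S \<subseteq> X}"


text \<open>
  The sheaf \<open>O(m)\<close>: a section over \<open>U\<close> is a function on the punctured affine cone over
  \<open>U\<close> that is locally a quotient of forms whose degrees differ by \<open>m\<close>.  It is extended by zero
  to all of \<open>complex^'i\<close>, so that equal sections are equal functions.
\<close>

definition twisting_sheaf :: "int \<Rightarrow> 'i::finite proj set \<Rightarrow> (complex^'i \<Rightarrow> complex) set" where
  "twisting_sheaf m U =
    {s. (\<forall>v. v \<notin> (\<Union>p\<in>U. line_of p - {0}) \<longrightarrow> s v = 0) \<and>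
        (\<forall>p\<in>U. \<exists>V a b. \<exists>g\<in>forms a. \<exists>h\<in>forms b.
           zariski_closed (- V) \<and> p \<in> V \<and> V \<subseteq> U \<and> int a - int b = m \<and>
           (\<forall>q\<in>V. \<forall>v \<in> line_of q - {0}. h v \<noteq> 0 \<and> s v = g v / h v))}"

text \<open>
  \<open>I\<^sub>X(m)\<close> for a closed set \<open>X\<close> with its reduced scheme structure: since \<open>X\<close> is reduced and
  \<open>O(m)\<close> is locally free, this is the subsheaf of \<open>O(m)\<close> of sections that vanish at all points
  of \<open>X\<close>.
\<close>

definition twisted_ideal_sheaf ::
  "'i::finite proj set \<Rightarrow> int \<Rightarrow> 'i proj set \<Rightarrow> (complex^'i \<Rightarrow> complex) set" where
  "twisted_ideal_sheaf X m U =
    {s \<in> twisting_sheaf m U. \<forall>p \<in> X \<inter> U. \<forall>v \<in> line_of p - {0}. s v = 0}"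

interpretation cfun: vector_space "\<lambda>(c::complex) (f :: 'a \<Rightarrow> complex) x. c * f x"
  by unfold_locales (auto simp: fun_eq_iff algebra_simps)


text \<open>
  The affine chart with respect to the homogeneous coordinate system given by an invertible
  matrix \<open>A\<close>; the index \<open>None\<close> is the homogenizing coordinate.
\<close>

definition affine_chart ::
  "complex^('n option)^('n option) \<Rightarrow> real^'n::finite \<Rightarrow> 'n option proj" where
  "affine_chart A x =
    proj_point (A *v (\<chi> j. case j of None \<Rightarrow> 1 | Some i \<Rightarrow> complex_of_real (x $ i)))"

text \<open>
  A polytope in projective space is the collection of its faces; it contains the whole space
  (the closure of the full-dimensional face) but not the empty face.
\<close>

definition full_dim_polytope :: "'n::finite option proj set set \<Rightarrow> bool" where
  "full_dim_polytope P \<longleftrightarrow>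
    (\<exists>A (Q :: (real^'n) set). invertible A \<and> polytope Q \<and> aff_dim Q = int CARD('n) \<and>
       P = {zariski_closure (affine_chart A ` F) | F. F face_of Q \<and> F \<noteq> {}})"

definition facets :: "'n::finite option proj set set \<Rightarrow> 'n option proj set set" where
  "facets P = {F \<in> P. proj_dim F = int CARD('n) - 1}"

definition vertices :: "'n::finite option proj set set \<Rightarrow> 'n option proj set set" where
  "vertices P = {F \<in> P. proj_dim F = 0}"

definition hyperplane_arrangement ::
  "'n::finite option proj set set \<Rightarrow> 'n option proj set set" where
  "hyperplane_arrangement P = proj_span ` facets P"

definition simple_arrangement :: "'n::finite option proj set set \<Rightarrow> bool" where
  "simple_arrangement \<H> \<longleftrightarrow> (\<forall>p. card {H \<in> \<H>. p \<in> H} \<le> CARD('n))"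

definition residual_arrangement ::
  "'n::finite option proj set set \<Rightarrow> 'n option proj set" where
  "residual_arrangement P =
    \<Union>{L. (\<exists>\<S> \<subseteq> hyperplane_arrangement P. L = \<Inter>\<S>) \<and> (\<forall>F\<in>P. \<not> F \<subseteq> L)}"

definition Omega :: "'n::finite option proj set set \<Rightarrow> (complex^('n option) \<Rightarrow> complex) set" where
  "Omega P = twisted_ideal_sheaf (residual_arrangement P)
     (int (card (facets P)) - int CARD('n)) UNIV"

end

theory Submission
  imports Defs "HOL-Complex_Analysis.Cauchy_Integral_Formula"
begin

text \<open>
  Let \<open>\<ell>\<^sub>F\<close> be a linear form cutting out the hyperplane of the facet \<open>F\<close>, and let \<open>m = d - n\<close>.  To each
  vertex \<open>v\<close> belongs the Wachspress form \<open>w\<^sub>v\<close>, the product of the \<open>\<ell>\<^sub>F\<close> over the facets \<open>F\<close> that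
  miss \<open>v\<close>.  The hyperplanes are in general position, so \<open>v\<close> lies on exactly \<open>n\<close> facets and \<open>w\<^sub>v\<close> has
  degree \<open>m\<close>.  A point of the residual arrangement lies on a family of hyperplanes that do not all
  pass through \<open>v\<close>, so \<open>w\<^sub>v\<close> vanishes there.  As \<open>w\<^sub>v\<close> is nonzero at \<open>v\<close> and zero at all other vertices,
  the Wachspress forms are linearly independent elements of \<open>\<Omega>\<^sub>P\<close>.

  They also span.  Any \<open>n\<close> of the hyperplanes meet in one point, which is either a vertex or a
  residual point.  From a section in \<open>\<Omega>\<^sub>P\<close> subtract the combination of Wachspress forms with the
  same values at the vertices; the difference \<open>r\<close> vanishes at all these \<open>n\<close>-fold points, and it
  remains to see that \<open>r = 0\<close> (\<open>zero_if_zero_on_star_configuration\<close>).  One shows by induction that \<open>r\<close>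
  vanishes on the intersections of \<open>n - 1\<close>, \<open>n - 2\<close>, ..., \<open>0\<close> hyperplanes: a general line through a
  given point of an intersection of fewer than \<open>n\<close> of them meets the remaining hyperplanes, of which
  there are more than \<open>m\<close>, in distinct points at which \<open>r\<close> is already known to vanish, whereas \<open>r\<close> is
  a polynomial of degree at most \<open>m\<close> on that line.

  Sections are given only as local quotients of forms; that they are polynomial on lines
  (\<open>section_polynomial_on_lines\<close>) comes from complex analysis.  On an affine line in the punctured
  cone a section is an entire function, and by homogeneity it grows at infinity at most like the
  power \<open>m\<close>, so that Liouville's theorem applies.

  The polytope enters through the correspondence between faces in the chart and linear subspaces
  of the cone (\<open>dim_cone_span\<close>), and through \<open>facets_through_vertex_lower_bound\<close>: a vertex on fewer
  than \<open>n\<close> facets could be moved both ways along a direction parallel to all of these facets.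
\<close>

section \<open>Linear forms\<close>

definition lform :: "complex^'i::finite \<Rightarrow> complex^'i \<Rightarrow> complex" where
  "lform c v = (\<Sum>i\<in>UNIV. c $ i * v $ i)"

lemma lform_add: "lform c (u + v) = lform c u + lform c v"
  by (simp add: lform_def algebra_simps sum.distrib)

lemma lform_scale: "lform c (t *s v) = t * lform c v"
  by (simp add: lform_def sum_distrib_left algebra_simps)

lemma lform_diff: "lform c (u - v) = lform c u - lform c v"
  by (simp add: lform_def algebra_simps sum_subtractf)

lemma lform_zero [simp]: "lform c 0 = 0"
  by (simp add: lform_def)

lemma lform_coeff_diff: "lform (c - d) v = lform c v - lform d v"
  by (simp add: lform_def algebra_simps sum_subtractf)

lemma lform_coeff_scale: "lform (t *s c) v = t * lform c v"
  by (simp add: lform_def sum_distrib_left algebra_simps)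

lemma subspace_lform_kernel: "vec.subspace {v. lform c v = 0}"
  by (auto simp: vec.subspace_def lform_add lform_scale)

lemma lform_separates_subspace:
  assumes "vec.subspace W" "v \<notin> W"
  obtains c where "\<And>w. w \<in> W \<Longrightarrow> lform c w = 0" "lform c v \<noteq> 0"
proof -
  obtain B where B: "B \<subseteq> W" "vec.independent B" "W \<subseteq> vec.span B"
    by (metis vec.maximal_independent_subset)
  have WB: "W = vec.span B"
    using B vec.span_minimal[OF B(1) assms(1)] by auto
  have "vec.independent (insert v B)"
    using assms B by (intro vec.independent_insertI) (simp_all add: WB)
  then obtain f where f: "Vector_Spaces.linear (*s) (*s) f"
      and fB: "\<And>x. x \<in> insert v B \<Longrightarrow> f x = (if x = v then axis undefined 1 else (0::complex^'a))"
    using vec.linear_independent_extend[of "insert v B" "\<lambda>x. if x = v then axis undefined 1 else 0"]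
    by metis
  have "v \<notin> B" using assms B by auto
  interpret f: Vector_Spaces.linear "(*s)" "(*s)" f by (rule f)
  have f0: "f w = 0" if "w \<in> W" for w
    by (rule f.eq_0_on_span[of B]) (use fB \<open>v \<notin> B\<close> that WB in auto)
  have m: "f x = matrix f *v x" for x
    using f by (metis matrix_of_matrix_vector_mul matrix_works)
  show ?thesis
  proof (rule that[of "matrix f $ undefined"])
    have *: "lform (matrix f $ undefined) x = f x $ undefined" for x
      by (simp add: m lform_def matrix_vector_mult_def)
    show "lform (matrix f $ undefined) w = 0" if "w \<in> W" for w
      by (simp add: * f0[OF that])
    show "lform (matrix f $ undefined) v \<noteq> 0"
      using fB[of v] by (simp add: * axis_def)
  qed
qed

text \<open>
  The kernel of a form that vanishes on \<open>W\<close> but not everywhere lies between \<open>W\<close> and the whole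
  space, and there is no room for another dimension.
\<close>

lemma lform_defines_hyperplane:
  fixes W :: "(complex^'i::finite) set"
  assumes W: "vec.subspace W" "vec.dim W + 1 = CARD('i)"
  obtains c where "\<And>v. lform c v = 0 \<longleftrightarrow> v \<in> W"
proof -
  have "W \<noteq> UNIV"
    using W vec_dim_card[where 'a = complex and 'n = 'i] by (metis add.right_neutral add_left_cancel zero_neq_one)
  then obtain v where "v \<notin> W" by auto
  then obtain c where c: "\<And>w. w \<in> W \<Longrightarrow> lform c w = 0" "lform c v \<noteq> 0"
    using lform_separates_subspace[OF W(1)] by metis
  let ?K = "{v. lform c v = 0}"
  have "vec.dim ?K < vec.dim (UNIV :: (complex^'i) set)"
    using c(2) by (intro vec.dim_psubset) (auto simp: vec.span_eq_iff[THEN iffD2, OF subspace_lform_kernel])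
  then have "W = ?K"
    using W c by (intro vec.subspace_dim_equal subspace_lform_kernel) (use vec_dim_card[where 'a = complex and 'n = 'i] in \<open>auto simp del: vec.dim_UNIV\<close>)
  then show ?thesis
    using that by blast
qed

text \<open>
  A complex subspace is not a finite union of proper subspaces: if \<open>x\<close> avoids the kernels treated
  so far and \<open>y\<close> avoids the next one, then all but finitely many points of the line \<open>x + t y\<close>
  avoid all of them.
\<close>

lemma lforms_common_nonzero:
  fixes C :: "(complex^'i::finite) set"
  assumes "finite C" "vec.subspace L" "\<And>c. c \<in> C \<Longrightarrow> \<exists>x\<in>L. lform c x \<noteq> 0"
  shows "\<exists>x\<in>L. \<forall>c\<in>C. lform c x \<noteq> 0"
  using assms(1,3)
proof (induction C rule: finite_induct)
  case empty
  then show ?case using vec.subspace_0[OF assms(2)] by auto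
next
  case (insert c C)
  then obtain x where x: "x \<in> L" "\<forall>d\<in>C. lform d x \<noteq> 0" by auto
  obtain y where y: "y \<in> L" "lform c y \<noteq> 0" using insert by auto
  let ?bad = "(\<lambda>d. - (lform d x / lform d y)) ` C \<union> {- (lform c x / lform c y)}"
  have "finite ?bad" using insert.hyps by simp
  then obtain t :: complex where t: "t \<notin> ?bad"
    using ex_new_if_finite infinite_UNIV_char_0 by blast
  have "lform d (x + t *s y) \<noteq> 0" if d: "d \<in> insert c C" for d
  proof
    assume "lform d (x + t *s y) = 0"
    then have e: "lform d x + t * lform d y = 0"
      by (simp add: lform_add lform_scale)
    have "lform d y \<noteq> 0"
      using e d x y by auto
    then have "t = - (lform d x / lform d y)"
      using e by (simp add: field_simps eq_neg_iff_add_eq_0)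
    then show False using t d by auto
  qed
  moreover have "x + t *s y \<in> L"
    using x y assms(2) by (simp add: vec.subspace_add vec.subspace_scale)
  ultimately show ?case by blast
qed

section \<open>Forms\<close>

lemma finite_exponents: "finite {\<alpha> :: 'i::finite \<Rightarrow> nat. sum \<alpha> UNIV = k}"
proof (rule finite_subset)
  have "\<alpha> i \<le> sum \<alpha> UNIV" for \<alpha> :: "'i \<Rightarrow> nat" and i
    by (rule member_le_sum) auto
  then show "{\<alpha> :: 'i \<Rightarrow> nat. sum \<alpha> UNIV = k} \<subseteq> (\<Pi>\<^sub>E i\<in>UNIV. {..k})"
    by (auto simp: PiE_def)
  show "finite (\<Pi>\<^sub>E i\<in>(UNIV::'i set). {..k})"
    by (rule finite_PiE) auto
qed

lemma formsE:
  assumes "f \<in> forms k"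
  obtains c where "f = (\<lambda>v. \<Sum>\<alpha> | sum \<alpha> UNIV = k. c \<alpha> * (\<Prod>i\<in>UNIV. (v $ i) ^ \<alpha> i))"
  using assms by (auto simp: forms_def)

lemma forms_scale:
  assumes "f \<in> forms k"
  shows "f (t *s v) = t ^ k * f v"
proof -
  obtain c where f: "f = (\<lambda>v. \<Sum>\<alpha> | sum \<alpha> UNIV = k. c \<alpha> * (\<Prod>i\<in>UNIV. (v $ i) ^ \<alpha> i))"
    using assms by (rule formsE)
  have "(\<Prod>i\<in>UNIV. ((t *s v) $ i) ^ \<alpha> i) = t ^ k * (\<Prod>i\<in>UNIV. (v $ i) ^ \<alpha> i)"
    if "sum \<alpha> UNIV = k" for \<alpha>
    using that power_sum[of t \<alpha> UNIV] by (simp add: power_mult_distrib prod.distrib)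
  then show ?thesis
    unfolding f sum_distrib_left by (intro sum.cong) (auto simp: algebra_simps)
qed

lemma forms_continuous_on:
  assumes "f \<in> forms k"
  shows "continuous_on X f"
proof -
  obtain c where f: "f = (\<lambda>v. \<Sum>\<alpha> | sum \<alpha> UNIV = k. c \<alpha> * (\<Prod>i\<in>UNIV. (v $ i) ^ \<alpha> i))"
    using assms by (rule formsE)
  show ?thesis
    unfolding f by (intro continuous_intros)
qed

lemma forms_holomorphic_on_line:
  assumes "f \<in> forms k"
  shows "(\<lambda>t. f (a + t *s b)) holomorphic_on X"
proof -
  obtain c where f: "f = (\<lambda>v. \<Sum>\<alpha> | sum \<alpha> UNIV = k. c \<alpha> * (\<Prod>i\<in>UNIV. (v $ i) ^ \<alpha> i))"
    using assms by (rule formsE)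
  show ?thesis
    unfolding f by (simp, intro holomorphic_intros)
qed

lemma forms_add:
  assumes "f \<in> forms k" "g \<in> forms k"
  shows "(\<lambda>v. f v + g v) \<in> forms k"
proof -
  obtain c where f: "f = (\<lambda>v. \<Sum>\<alpha> | sum \<alpha> UNIV = k. c \<alpha> * (\<Prod>i\<in>UNIV. (v $ i) ^ \<alpha> i))"
    using assms(1) by (rule formsE)
  obtain d where g: "g = (\<lambda>v. \<Sum>\<alpha> | sum \<alpha> UNIV = k. d \<alpha> * (\<Prod>i\<in>UNIV. (v $ i) ^ \<alpha> i))"
    using assms(2) by (rule formsE)
  show ?thesis
    unfolding forms_def mem_Collect_eq
    by (rule exI[of _ "\<lambda>\<alpha>. c \<alpha> + d \<alpha>"]) (simp add: f g algebra_simps sum.distrib)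
qed

lemma forms_scalar_mult:
  assumes "f \<in> forms k"
  shows "(\<lambda>v. t * f v) \<in> forms k"
proof -
  obtain c where f: "f = (\<lambda>v. \<Sum>\<alpha> | sum \<alpha> UNIV = k. c \<alpha> * (\<Prod>i\<in>UNIV. (v $ i) ^ \<alpha> i))"
    using assms(1) by (rule formsE)
  show ?thesis
    unfolding forms_def mem_Collect_eq
    by (rule exI[of _ "\<lambda>\<alpha>. t * c \<alpha>"]) (simp add: f algebra_simps sum_distrib_left)
qed

lemma forms_zero: "(\<lambda>v. 0) \<in> forms k"
  unfolding forms_def mem_Collect_eq by (rule exI[of _ "\<lambda>_. 0"]) simp

lemma one_in_forms: "(\<lambda>v. 1) \<in> forms 0"
proof -
  have "{\<alpha> :: 'a \<Rightarrow> nat. sum \<alpha> UNIV = 0} = {\<lambda>_. 0}"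
    by (auto simp: fun_eq_iff)
  then show ?thesis
    unfolding forms_def mem_Collect_eq by (intro exI[of _ "\<lambda>_. 1"]) simp
qed

text \<open>
  Multiplying by the coordinate \<open>j\<close> shifts the exponent vectors up at \<open>j\<close>, so the coefficients of
  the product are those of \<open>f\<close> at the vectors shifted back down.
\<close>

lemma forms_coordinate_mult:
  fixes f :: "complex^'i::finite \<Rightarrow> complex"
  assumes "f \<in> forms k"
  shows "(\<lambda>v. v $ j * f v) \<in> forms (Suc k)"
proof -
  obtain c where f: "f = (\<lambda>v. \<Sum>\<alpha> | sum \<alpha> UNIV = k. c \<alpha> * (\<Prod>i\<in>UNIV. (v $ i) ^ \<alpha> i))"
    using assms(1) by (rule formsE)
  define up where "up \<alpha> = \<alpha>(j := Suc (\<alpha> j))" for \<alpha> :: "'i \<Rightarrow> nat"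
  define down where "down \<alpha> = \<alpha>(j := \<alpha> j - 1)" for \<alpha> :: "'i \<Rightarrow> nat"
  have sum_up: "sum (up \<alpha>) UNIV = Suc (sum \<alpha> UNIV)" for \<alpha>
    by (simp add: sum.remove[of UNIV j] up_def)
  have down_up [simp]: "down (up \<alpha>) = \<alpha>" for \<alpha>
    by (simp add: up_def down_def)
  have up_down: "up (down \<alpha>) = \<alpha>" if "\<alpha> j \<noteq> 0" for \<alpha>
    using that by (simp add: up_def down_def fun_eq_iff)
  have monom_up: "(\<Prod>i\<in>UNIV. (v $ i) ^ up \<alpha> i) = v $ j * (\<Prod>i\<in>UNIV. (v $ i) ^ \<alpha> i)"
    for v :: "complex^'i" and \<alpha>
    by (simp add: prod.remove[of UNIV j] up_def)
  define c' where "c' \<alpha> = (if \<alpha> j = 0 then 0 else c (down \<alpha>))" for \<alpha>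
  have c'_up: "c' (up \<alpha>) = c \<alpha>" for \<alpha>
    unfolding c'_def by (simp add: up_def down_def)
  have "v $ j * f v = (\<Sum>\<alpha> | sum \<alpha> UNIV = Suc k. c' \<alpha> * (\<Prod>i\<in>UNIV. (v $ i) ^ \<alpha> i))" for v
  proof -
    have "v $ j * f v = (\<Sum>\<alpha> | sum \<alpha> UNIV = k. c' (up \<alpha>) * (\<Prod>i\<in>UNIV. (v $ i) ^ up \<alpha> i))"
      unfolding f sum_distrib_left monom_up
      by (intro sum.cong refl) (simp add: c'_up)
    also have "\<dots> = (\<Sum>\<alpha> | sum \<alpha> UNIV = Suc k \<and> \<alpha> j \<noteq> 0. c' \<alpha> * (\<Prod>i\<in>UNIV. (v $ i) ^ \<alpha> i))"
    proof (rule sum.reindex_bij_witness[of _ down up])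
      show "down \<alpha> \<in> {\<alpha>. sum \<alpha> UNIV = k}" if "\<alpha> \<in> {\<alpha>. sum \<alpha> UNIV = Suc k \<and> \<alpha> j \<noteq> 0}" for \<alpha>
        using that sum_up[of "down \<alpha>"] up_down[of \<alpha>] by simp
      show "up \<alpha> \<in> {\<alpha>. sum \<alpha> UNIV = Suc k \<and> \<alpha> j \<noteq> 0}" if "\<alpha> \<in> {\<alpha>. sum \<alpha> UNIV = k}" for \<alpha>
        using that sum_up[of \<alpha>] by (simp add: up_def)
    qed (simp_all add: up_down)
    also have "\<dots> = (\<Sum>\<alpha> | sum \<alpha> UNIV = Suc k. c' \<alpha> * (\<Prod>i\<in>UNIV. (v $ i) ^ \<alpha> i))"
      by (rule sum.mono_neutral_left) (auto simp: c'_def finite_exponents)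
    finally show ?thesis .
  qed
  then show ?thesis
    unfolding forms_def by blast
qed

lemma forms_sum:
  assumes "\<And>i. i \<in> I \<Longrightarrow> f i \<in> forms k"
  shows "(\<lambda>v. \<Sum>i\<in>I. f i v) \<in> forms k"
  using assms by (induction I rule: infinite_finite_induct) (auto intro: forms_add forms_zero)

lemma forms_lform_mult:
  assumes "f \<in> forms k"
  shows "(\<lambda>v. lform c v * f v) \<in> forms (Suc k)"
proof -
  have "(\<lambda>v. \<Sum>i\<in>UNIV. c $ i * (v $ i * f v)) \<in> forms (Suc k)"
    by (intro forms_sum forms_scalar_mult forms_coordinate_mult assms)
  then show ?thesis
    by (simp add: lform_def sum_distrib_right mult.assoc)
qed

lemma lform_in_forms: "lform c \<in> forms 1"
  using forms_lform_mult[OF one_in_forms, of c] by simp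

lemma prod_lforms_in_forms:
  assumes "finite I"
  shows "(\<lambda>v. \<Prod>i\<in>I. lform (c i) v) \<in> forms (card I)"
  using assms by induction (auto intro: one_in_forms forms_lform_mult)

section \<open>Points of projective space\<close>

lemma line_of_subspace: "vec.subspace (line_of p)" and line_of_dim: "vec.dim (line_of p) = 1"
  using line_of[of p] by auto

lemma line_of_proj_point:
  assumes "v \<noteq> 0"
  shows "line_of (proj_point v) = vec.span {v}"
proof -
  have "vec.dim (vec.span {v}) = 1"
    using assms by (simp add: vec.dim_span vec.dim_eq_card_independent)
  then show ?thesis
    unfolding proj_point_def by (subst Proj_inverse) auto
qed

lemma mem_line_of_proj_point: "v \<noteq> 0 \<Longrightarrow> v \<in> line_of (proj_point v)"
  by (simp add: line_of_proj_point vec.span_base)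

lemma line_of_eq_span:
  assumes "v \<in> line_of p" "v \<noteq> 0"
  shows "line_of p = vec.span {v}"
proof -
  have "vec.span {v} = line_of p"
    using assms
    by (intro vec.subspace_dim_equal vec.subspace_span line_of_subspace vec.span_minimal)
       (auto simp: line_of_dim vec.dim_eq_card_independent)
  then show ?thesis ..
qed

lemma proj_point_eq:
  assumes "v \<in> line_of p" "v \<noteq> 0"
  shows "proj_point v = p"
  using line_of_eq_span[OF assms] line_of_proj_point[OF assms(2)] line_of_inject by metis

lemma exists_nonzero_on_line: "\<exists>v\<in>line_of p. v \<noteq> 0"
proof (rule ccontr)
  assume "\<not> ?thesis"
  then have "line_of p \<subseteq> {0}" by auto
  then have "vec.dim (line_of p) = 0" by simp
  then show False using line_of_dim[of p] by simp
qed

text \<open>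
  A subspace is the common zero set of the linear forms that vanish on it.
\<close>

lemma zariski_closed_linear_space:
  assumes "vec.subspace W"
  shows "zariski_closed {p. line_of p \<subseteq> W}"
proof -
  let ?G = "{lform c | c. \<forall>w\<in>W. lform c w = 0}"
  have "line_of p \<subseteq> W \<longleftrightarrow> (\<forall>g\<in>?G. \<forall>v\<in>line_of p - {0}. g v = 0)" for p
  proof
    show "line_of p \<subseteq> W" if H: "\<forall>g\<in>?G. \<forall>v\<in>line_of p - {0}. g v = 0"
    proof
      fix v assume v: "v \<in> line_of p"
      show "v \<in> W"
      proof (rule ccontr)
        assume "v \<notin> W"
        then obtain c where c: "\<And>w. w \<in> W \<Longrightarrow> lform c w = 0" "lform c v \<noteq> 0"
          using lform_separates_subspace[OF assms] by metis
        have "lform c \<in> ?G" using c(1) by blast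
        moreover have "v \<in> line_of p - {0}" using v c(2) by auto
        ultimately show False using H c(2) by blast
      qed
    qed
  qed auto
  moreover have "?G \<subseteq> (\<Union>k. forms k)"
    using lform_in_forms by blast
  ultimately show ?thesis
    unfolding zariski_closed_def by blast
qed

section \<open>Sections of the twisting sheaf\<close>

text \<open>
  This carries Zariski neighbourhoods over to the Euclidean topology, in which sections can be
  treated as holomorphic functions.  Whether a form vanishes depends only on the line, so one
  representative of each point is enough.
\<close>

lemma open_punctured_cone:
  assumes "zariski_closed (- V)"
  shows "open {v. v \<noteq> 0 \<and> proj_point v \<in> V}"
proof -
  obtain G where G: "G \<subseteq> (\<Union>k. forms k)" "- V = {p. \<forall>g\<in>G. \<forall>v\<in>line_of p - {0}. g v = 0}"
    using assms unfolding zariski_closed_def by blast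
  have V: "proj_point v \<in> V \<longleftrightarrow> (\<exists>g\<in>G. g v \<noteq> 0)" if v: "v \<noteq> 0" for v
  proof -
    have "proj_point v \<in> V \<longleftrightarrow> (\<exists>g\<in>G. \<exists>u\<in>line_of (proj_point v) - {0}. g u \<noteq> 0)"
      using G(2) by blast
    also have "\<dots> \<longleftrightarrow> (\<exists>g\<in>G. g v \<noteq> 0)"
    proof
      assume "\<exists>g\<in>G. \<exists>u\<in>line_of (proj_point v) - {0}. g u \<noteq> 0"
      then obtain g u where g: "g \<in> G" "u \<in> line_of (proj_point v)" "g u \<noteq> 0"
        by blast
      obtain t where "u = t *s v"
        using g v by (auto simp: line_of_proj_point vec.span_singleton)
      moreover obtain k where "g \<in> forms k" using g G by auto
      ultimately have "g v \<noteq> 0"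
        using g(3) forms_scale[of g k t v] by auto
      then show "\<exists>g\<in>G. g v \<noteq> 0"
        using g(1) by blast
    next
      assume "\<exists>g\<in>G. g v \<noteq> 0"
      then show "\<exists>g\<in>G. \<exists>u\<in>line_of (proj_point v) - {0}. g u \<noteq> 0"
        using v mem_line_of_proj_point by blast
    qed
    finally show ?thesis .
  qed
  have "{v. v \<noteq> 0 \<and> proj_point v \<in> V} = - {0} \<inter> (\<Union>g\<in>G. g -` (- {0}))"
    using V by auto
  moreover have "open (g -` (- {0}))" if "g \<in> G" for g
    using that G(1) forms_continuous_on by (intro open_vimage) blast+
  ultimately show ?thesis
    by (simp add: open_Int open_UN open_Compl)
qed

text \<open>
  A local presentation of a section, with the neighbourhood taken in the punctured cone and
  invariant under scaling.
\<close>

lemma section_locally_quotient: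
  assumes s: "s \<in> twisting_sheaf (int m) UNIV" and v: "v \<noteq> 0"
  obtains g h a b U where "g \<in> forms a" "h \<in> forms b" "a = b + m" "open U" "v \<in> U"
    "\<And>u. u \<in> U \<Longrightarrow> h u \<noteq> 0 \<and> s u = g u / h u"
    "\<And>u t. u \<in> U \<Longrightarrow> t \<noteq> 0 \<Longrightarrow> t *s u \<in> U"
proof -
  have "\<exists>V a b. \<exists>g\<in>forms a. \<exists>h\<in>forms b.
      zariski_closed (- V) \<and> proj_point v \<in> V \<and> V \<subseteq> UNIV \<and> int a - int b = int m \<and>
      (\<forall>q\<in>V. \<forall>v\<in>line_of q - {0}. h v \<noteq> 0 \<and> s v = g v / h v)"
    using s unfolding twisting_sheaf_def by simp
  then obtain V a b g h where
    H: "g \<in> forms a" "h \<in> forms b" "zariski_closed (- V)" "proj_point v \<in> V" "int a - int b = int m"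
    "\<forall>q\<in>V. \<forall>v\<in>line_of q - {0}. h v \<noteq> 0 \<and> s v = g v / h v"
    by blast
  show ?thesis
  proof (rule that[OF H(1,2)])
    show "open {v. v \<noteq> 0 \<and> proj_point v \<in> V}"
      by (rule open_punctured_cone[OF H(3)])
    show "t *s u \<in> {v. v \<noteq> 0 \<and> proj_point v \<in> V}"
      if u: "u \<in> {v. v \<noteq> 0 \<and> proj_point v \<in> V}" "t \<noteq> 0" for u t
    proof -
      have "t *s u \<noteq> 0" using u by simp
      moreover have "proj_point (t *s u) = proj_point u"
        using u by (intro proj_point_eq) (auto simp: line_of_proj_point vec.span_base vec.span_scale)
      ultimately show ?thesis using u by auto
    qed
  qed (use H v mem_line_of_proj_point in auto)
qed

lemma section_at_zero: "s \<in> twisting_sheaf m U \<Longrightarrow> s 0 = 0"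
  by (simp add: twisting_sheaf_def)

lemma section_scale:
  assumes s: "s \<in> twisting_sheaf (int m) UNIV" and t: "t \<noteq> 0"
  shows "s (t *s v) = t ^ m * s v"
proof (cases "v = 0")
  case True
  then show ?thesis using section_at_zero[OF s] by simp
next
  case False
  then obtain g h a b U where
    U: "g \<in> forms a" "h \<in> forms b" "a = b + m" "v \<in> U"
    "\<And>u. u \<in> U \<Longrightarrow> h u \<noteq> 0 \<and> s u = g u / h u"
    "\<And>u t. u \<in> U \<Longrightarrow> t \<noteq> 0 \<Longrightarrow> t *s u \<in> U"
    using section_locally_quotient[OF s, of v] by metis
  have "s (t *s v) = (t ^ a * g v) / (t ^ b * h v)"
    using U t by (metis forms_scale)
  also have "\<dots> = t ^ m * s v"
    using U t by (simp add: power_add)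
  finally show ?thesis .
qed

lemma zariski_closed_empty: "zariski_closed ({} :: 'i::finite proj set)"
proof -
  have "{\<lambda>v. 1} \<subseteq> (\<Union>k. forms k :: (complex^'i \<Rightarrow> complex) set)"
    using one_in_forms by blast
  moreover have "{} = {p :: 'i proj. \<forall>g\<in>{\<lambda>v. 1 :: complex}. \<forall>v\<in>line_of p - {0}. g v = 0}"
    using exists_nonzero_on_line by auto
  ultimately show ?thesis
    unfolding zariski_closed_def by blast
qed

text \<open>
  A section is zero at the origin by convention, which agrees with the value of a form only in
  positive degree.
\<close>

lemma form_is_global_section:
  fixes f :: "complex^'i::finite \<Rightarrow> complex"
  assumes "f \<in> forms m" "m > 0"
  shows "f \<in> twisting_sheaf (int m) UNIV"
  unfolding twisting_sheaf_def
proof (intro CollectI conjI allI impI ballI)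
  fix v :: "complex^'i" assume "v \<notin> (\<Union>p\<in>UNIV. line_of p - {0})"
  then have "v = 0" using mem_line_of_proj_point by blast
  then show "f v = 0" using forms_scale[OF assms(1), of 0 0] assms(2) by (simp add: zero_power)
next
  fix p :: "'i proj"
  have quotient: "zariski_closed (- UNIV :: 'i proj set) \<and> p \<in> UNIV \<and> (UNIV :: 'i proj set) \<subseteq> UNIV \<and>
      int m - int 0 = int m \<and>
      (\<forall>q\<in>(UNIV :: 'i proj set). \<forall>v\<in>line_of q - {0}. (1::complex) \<noteq> 0 \<and> f v = f v / 1)"
    using zariski_closed_empty by simp
  show "\<exists>V a b. \<exists>g\<in>forms a. \<exists>h\<in>forms b.
      zariski_closed (- V) \<and> p \<in> V \<and> V \<subseteq> UNIV \<and> int a - int b = int m \<and>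
      (\<forall>q\<in>V. \<forall>v\<in>line_of q - {0}. h v \<noteq> 0 \<and> f v = g v / h v)"
    by (rule exI[of _ UNIV], rule exI[of _ m], rule exI[of _ 0], rule bexI[OF _ assms(1)],
        rule bexI[OF _ one_in_forms], rule quotient)
qed

text \<open>
  Lines through the origin are excluded because nothing is known about a section near \<open>0\<close>.  Forms
  and sections both have this property, and it passes to linear combinations, which for sections
  themselves would need a common denominator.
\<close>

definition polynomial_on_lines :: "nat \<Rightarrow> (complex^'i::finite \<Rightarrow> complex) \<Rightarrow> bool" where
  "polynomial_on_lines m f \<longleftrightarrow>
    (\<forall>a b. b \<noteq> 0 \<longrightarrow> (\<forall>t. a + t *s b \<noteq> 0) \<longrightarrow> (\<exists>q. \<forall>t. f (a + t *s b) = (\<Sum>k\<le>m. q k * t ^ k)))"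

text \<open>
  The identity \<open>s (a + z b) = z\<^sup>m s (b + a / z)\<close> turns the behaviour of \<open>s\<close> at the far end of the
  line into its behaviour near \<open>b\<close>, where it is continuous and hence bounded.
\<close>

lemma section_polynomial_on_lines:
  fixes s :: "complex^'i::finite \<Rightarrow> complex"
  assumes s: "s \<in> twisting_sheaf (int m) UNIV"
  shows "polynomial_on_lines m s"
  unfolding polynomial_on_lines_def
proof (intro allI impI)
  fix a b :: "complex^'i" assume b: "b \<noteq> 0" and "\<forall>t. a + t *s b \<noteq> 0"
  then have ab: "\<And>t. a + t *s b \<noteq> 0" by blast
  let ?f = "\<lambda>t. s (a + t *s b)"
  have cont_line: "continuous_on UNIV (\<lambda>t::complex. x + t *s y)" for x y :: "complex^'i"
    unfolding vector_scalar_mult_def by (intro continuous_intros continuous_on_vec_lambda)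
  have "?f holomorphic_on UNIV"
    unfolding holomorphic_on_def
  proof
    fix t0
    obtain g h i j U where
      U: "g \<in> forms i" "h \<in> forms j" "open U" "a + t0 *s b \<in> U"
      "\<And>u. u \<in> U \<Longrightarrow> h u \<noteq> 0 \<and> s u = g u / h u"
      using section_locally_quotient[OF s ab[of t0]] by metis
    let ?T = "(\<lambda>t. a + t *s b) -` U"
    have T: "open ?T" by (rule open_vimage[OF U(3) cont_line])
    have "(\<lambda>t. g (a + t *s b) / h (a + t *s b)) holomorphic_on ?T"
      using U by (intro holomorphic_on_divide forms_holomorphic_on_line) auto
    then have "?f holomorphic_on ?T"
      by (rule holomorphic_transform) (use U in auto)
    then show "?f field_differentiable at t0 within UNIV"
      using T U by (simp add: holomorphic_on_imp_differentiable_at)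
  qed
  \<comment> \<open>The growth bound for the polynomial version of Liouville's theorem.\<close>
  moreover obtain A B where "\<And>z. A \<le> norm z \<Longrightarrow> norm (?f z) \<le> B * norm z ^ m"
  proof -
    obtain g h i j U where
      U: "g \<in> forms i" "h \<in> forms j" "open U" "b \<in> U"
      "\<And>u. u \<in> U \<Longrightarrow> h u \<noteq> 0 \<and> s u = g u / h u"
      using section_locally_quotient[OF s b] by metis
    have "continuous_on U (\<lambda>u. g u / h u)"
      using U by (intro continuous_intros forms_continuous_on) auto
    then have "continuous_on U s"
      by (rule continuous_on_eq) (use U in auto)
    then have "isCont s b"
      using U(3,4) continuous_on_eq_continuous_at by blast
    moreover have line: "isCont (\<lambda>t. b + t *s a) 0"
      using cont_line continuous_on_eq_continuous_at by blast
    ultimately have "isCont (\<lambda>t. s (b + t *s a)) 0"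
      by (intro isCont_o2[OF line]) simp
    then have "\<forall>\<^sub>F t in at 0. dist (s (b + t *s a)) (s b) < 1"
      unfolding isCont_def by (intro tendstoD) auto
    then obtain d where d: "d > 0" "\<And>t. t \<noteq> 0 \<Longrightarrow> norm t < d \<Longrightarrow> dist (s (b + t *s a)) (s b) < 1"
      unfolding eventually_at by auto
    have "norm (?f z) \<le> (norm (s b) + 1) * norm z ^ m" if z: "2 / d \<le> norm z" for z
    proof -
      have "0 < 2 / d" using d by simp
      then have z0: "z \<noteq> 0" using z by auto
      have "1 < d * norm z"
        using z d by (simp add: pos_divide_le_eq mult.commute)
      then have "1 / norm z < d"
        using z0 by (simp add: pos_divide_less_eq)
      then have "norm (inverse z) < d"
        by (simp add: norm_inverse divide_inverse)
      then have "dist (s (b + inverse z *s a)) (s b) < 1"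
        using d z0 by simp
      then have bound: "norm (s (b + inverse z *s a)) \<le> norm (s b) + 1"
        using norm_triangle_sub[of "s (b + inverse z *s a)" "s b"] by (simp add: dist_norm)
      have eq: "a + z *s b = z *s (b + inverse z *s a)"
        using z0 by (simp add: vec_eq_iff field_simps)
      have "norm (?f z) = norm (s (b + inverse z *s a)) * norm z ^ m"
        by (simp only: eq section_scale[OF s z0] norm_mult norm_power mult.commute)
      then show ?thesis
        using bound by (simp add: mult_right_mono)
    qed
    then show ?thesis using that by blast
  qed
  ultimately have "?f t = (\<Sum>k\<le>m. (deriv ^^ k) ?f 0 / fact k * t ^ k)" for t
    by (rule Liouville_polynomial)
  then show "\<exists>q. \<forall>t. ?f t = (\<Sum>k\<le>m. q k * t ^ k)"
    by (intro exI allI)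
qed

lemma polynomial_on_lines_diff:
  assumes "polynomial_on_lines m f" "polynomial_on_lines m g"
  shows "polynomial_on_lines m (\<lambda>v. f v - g v)"
  unfolding polynomial_on_lines_def
proof (intro allI impI)
  fix a b :: "complex^'a" assume "b \<noteq> 0" "\<forall>t. a + t *s b \<noteq> 0"
  then obtain p q where "\<And>t. f (a + t *s b) = (\<Sum>k\<le>m. p k * t ^ k)"
      and "\<And>t. g (a + t *s b) = (\<Sum>k\<le>m. q k * t ^ k)"
    using assms unfolding polynomial_on_lines_def by metis
  then show "\<exists>r. \<forall>t. f (a + t *s b) - g (a + t *s b) = (\<Sum>k\<le>m. r k * t ^ k)"
    by (intro exI[of _ "\<lambda>k. p k - q k"]) (simp add: left_diff_distrib sum_subtractf)
qed

lemma polynomial_on_lines_scale: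
  assumes "polynomial_on_lines m f"
  shows "polynomial_on_lines m (\<lambda>v. c * f v)"
  unfolding polynomial_on_lines_def
proof (intro allI impI)
  fix a b :: "complex^'a" assume "b \<noteq> 0" "\<forall>t. a + t *s b \<noteq> 0"
  then obtain p where "\<And>t. f (a + t *s b) = (\<Sum>k\<le>m. p k * t ^ k)"
    using assms unfolding polynomial_on_lines_def by metis
  then show "\<exists>r. \<forall>t. c * f (a + t *s b) = (\<Sum>k\<le>m. r k * t ^ k)"
    by (intro exI[of _ "\<lambda>k. c * p k"]) (simp add: sum_distrib_left mult.assoc)
qed

lemma polynomial_on_lines_zero: "polynomial_on_lines m (\<lambda>v. 0)"
  unfolding polynomial_on_lines_def by (intro allI impI exI[of _ "\<lambda>k. 0"]) simp

lemma polynomial_on_lines_sum: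
  assumes "finite I" "\<And>i. i \<in> I \<Longrightarrow> polynomial_on_lines m (f i)"
  shows "polynomial_on_lines m (\<lambda>v. \<Sum>i\<in>I. f i v)"
  using assms
proof (induction I rule: finite_induct)
  case (insert i I)
  then have "polynomial_on_lines m (\<lambda>v. f i v - - 1 * (\<Sum>i\<in>I. f i v))"
    by (intro polynomial_on_lines_diff polynomial_on_lines_scale) auto
  then show ?case using insert.hyps by simp
qed (simp add: polynomial_on_lines_zero)

section \<open>Hyperplanes in general position\<close>

text \<open>
  No point of the projective space lies on as many hyperplanes as there are homogeneous coordinates.
\<close>

definition general_position :: "('b \<Rightarrow> complex^'i::finite) \<Rightarrow> 'b set \<Rightarrow> bool" where
  "general_position c I \<longleftrightarrow>
    (\<forall>T \<subseteq> I. card T = CARD('i) \<longrightarrow> (\<forall>v. (\<forall>i\<in>T. lform (c i) v = 0) \<longrightarrow> v = 0))"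

lemma general_positionD:
  fixes c :: "'b \<Rightarrow> complex^'i::finite"
  assumes "general_position c I" "T \<subseteq> I" "card T = CARD('i)" "\<And>i. i \<in> T \<Longrightarrow> lform (c i) v = 0"
  shows "v = 0"
  using assms unfolding general_position_def by blast

text \<open>
  After enlarging \<open>T\<close> to as many forms as there are coordinates, the matrix with these forms as
  rows is injective by general position, hence surjective.
\<close>

lemma general_position_prescribed_values:
  fixes c :: "'b \<Rightarrow> complex^'i::finite"
  assumes gp: "general_position c I" and fin: "finite I" and I: "CARD('i) \<le> card I"
    and T: "T \<subseteq> I" "card T \<le> CARD('i)"
  obtains v where "\<And>i. i \<in> T \<Longrightarrow> lform (c i) v = x i"
proof -
  obtain T' where T': "T \<subseteq> T'" "T' \<subseteq> I" "card T' = CARD('i)"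
    using exists_subset_between[OF T(2) I T(1) fin] by blast
  have "finite T'" using T' fin finite_subset by blast
  then obtain e where e: "bij_betw e (UNIV :: 'i set) T'"
    using T'(3) finite_same_card_bij[of "UNIV :: 'i set" T'] by auto
  define M :: "complex^'i^'i" where "M = (\<chi> j. c (e j))"
  have M: "(M *v v) $ j = lform (c (e j)) v" for v j
    by (simp add: M_def matrix_vector_mult_def lform_def)
  have "v = 0" if "M *v v = 0" for v
  proof -
    have "lform (c i) v = 0" if "i \<in> T'" for i
    proof -
      obtain j where "i = e j" using \<open>i \<in> T'\<close> e unfolding bij_betw_def by blast
      then show ?thesis using M[of v j] \<open>M *v v = 0\<close> by simp
    qed
    then show ?thesis
      using general_positionD[OF gp T'(2,3)] by blast
  qed
  then have "inj ((*v) M)"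
    by (simp add: vec.inj_iff_eq_0)
  then have "surj ((*v) M)"
    by (intro vec.linear_inj_imp_surj) auto
  then obtain v where v: "M *v v = (\<chi> j. x (e j))"
    by (metis surjD)
  show ?thesis
  proof (rule that[of v])
    fix i assume "i \<in> T"
    then obtain j where "i = e j" using T' e unfolding bij_betw_def by blast
    then show "lform (c i) v = x i"
      using M[of v j] v by simp
  qed
qed

lemma zero_on_line:
  assumes s: "polynomial_on_lines m s" and b: "b \<noteq> 0" and ab: "\<And>t. a + t *s b \<noteq> 0"
    and Z: "m < card Z" "\<And>t. t \<in> Z \<Longrightarrow> s (a + t *s b) = 0"
  shows "s (a + t *s b) = 0"
proof -
  obtain q where q: "\<And>t. s (a + t *s b) = (\<Sum>k\<le>m. q k * t ^ k)"
    using s b ab unfolding polynomial_on_lines_def by blast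
  have "q k = 0" if "k \<le> m" for k
  proof (rule ccontr)
    assume "q k \<noteq> 0"
    then have "finite {z. (\<Sum>k\<le>m. q k * z ^ k) = 0}" "card {z. (\<Sum>k\<le>m. q k * z ^ k) = 0} \<le> m"
      using polyfun_rootbound[of m q] that by blast+
    moreover have "Z \<subseteq> {z. (\<Sum>k\<le>m. q k * z ^ k) = 0}"
      using Z(2) q by auto
    ultimately show False
      using Z(1) card_mono[of "{z. (\<Sum>k\<le>m. q k * z ^ k) = 0}" Z] by linarith
  qed
  then show ?thesis by (simp add: q)
qed

text \<open>
  The induction goes down from the intersections of \<open>CARD('i) - 1\<close> hyperplanes to the
  intersection of none.  With one hyperplane fewer, let \<open>v\<close> be a point of the intersection \<open>L\<close> that
  lies on none of the remaining hyperplanes (otherwise the induction hypothesis applies to it).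
  The line from \<open>v\<close> in a direction \<open>b \<in> L\<close> meets the hyperplane \<open>i\<close> at the parameter
  \<open>- \<ell>\<^sub>i v / \<ell>\<^sub>i b\<close>.  For these parameters to exist and be distinct, \<open>b\<close> has to avoid the kernels of
  the forms \<open>\<ell>\<^sub>i\<close> and \<open>\<ell>\<^sub>i v \<ell>\<^sub>j - \<ell>\<^sub>j v \<ell>\<^sub>i\<close>, none of which contains \<open>L\<close>, by general position.  More than
  \<open>m\<close> zeros on one line force the value \<open>0\<close> at \<open>v\<close> itself.
\<close>

lemma zero_if_zero_on_star_configuration:
  fixes c :: "'b \<Rightarrow> complex^'i::finite"
  assumes gp: "general_position c I" and fin: "finite I" and cardI: "card I + 1 = CARD('i) + m"
    and m: "m > 0" and s: "polynomial_on_lines m s"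
    and points: "\<And>S v. S \<subseteq> I \<Longrightarrow> card S + 1 = CARD('i) \<Longrightarrow> (\<And>i. i \<in> S \<Longrightarrow> lform (c i) v = 0) \<Longrightarrow> s v = 0"
  shows "s v = 0"
proof -
  have claim: "s v = 0"
    if "S \<subseteq> I" "card S + k + 1 = CARD('i)" "\<And>i. i \<in> S \<Longrightarrow> lform (c i) v = 0" for S k v
    using that
  proof (induction k arbitrary: S v)
    case 0
    then show ?case using points[of S v] by simp
  next
    case (Suc k)
    define R where "R = I - S"
    have finS: "finite S" using Suc.prems fin finite_subset by blast
    \<comment> \<open>The remaining hyperplanes; there are at least two of them, as \<open>m > 0\<close>.\<close>
    have cardR: "card R = m + k + 1"
      using Suc.prems finS cardI unfolding R_def by (simp add: card_Diff_subset)
    have finR: "finite R" using fin by (simp add: R_def)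
    have IH: "s u = 0" if "i \<in> R" "lform (c i) u = 0" "\<And>j. j \<in> S \<Longrightarrow> lform (c j) u = 0" for i u
      by (rule Suc.IH[of "insert i S"]) (use that Suc.prems finS in \<open>auto simp: R_def\<close>)
    show ?case
    proof (cases "\<exists>i\<in>R. lform (c i) v = 0")
      case True
      then show ?thesis using IH Suc.prems by blast
    next
      case False
      define L where "L = {u. \<forall>i\<in>S. lform (c i) u = 0}"
      have L: "vec.subspace L"
        by (auto simp: L_def vec.subspace_def lform_add lform_scale)
      define D where "D = (\<lambda>(i, j). lform (c i) v *s c j - lform (c j) v *s c i)"
      define C where "C = c ` R \<union> D ` {(i, j). i \<in> R \<and> j \<in> R \<and> i \<noteq> j}"
      have "finite {(i, j). i \<in> R \<and> j \<in> R \<and> i \<noteq> j}"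
        by (rule finite_subset[of _ "R \<times> R"]) (use finR in auto)
      then have "finite C"
        using finR by (simp add: C_def)
      have val: "\<exists>u\<in>L. lform (c i) u = 0 \<and> lform (c j) u = 1" if "i \<in> R" "j \<in> R" "i \<noteq> j" for i j
      proof -
        have "card (insert i (insert j S)) \<le> CARD('i)"
          using Suc.prems(2) finS by (auto simp: card_insert_if)
        moreover have "insert i (insert j S) \<subseteq> I"
          using that Suc.prems(1) by (auto simp: R_def)
        moreover have "CARD('i) \<le> card I"
          using cardI m by linarith
        ultimately obtain u where
          u: "\<And>l. l \<in> insert i (insert j S) \<Longrightarrow> lform (c l) u = (if l = j then 1 else 0)"
          using general_position_prescribed_values[OF gp fin, of "insert i (insert j S)"
              "\<lambda>l. if l = j then 1 else 0"] by metis
        have "u \<in> L"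
          using that(2) u by (auto simp: L_def R_def)
        then show ?thesis
          using u[of i] u[of j] that(3) by auto
      qed
      have pick: "\<exists>j\<in>R. j \<noteq> i" for i
      proof (rule ccontr)
        assume "\<not> ?thesis"
        then have "R \<subseteq> {i}" by auto
        then have "card R \<le> 1" using card_mono[of "{i}" R] by simp
        then show False using cardR m by simp
      qed
      have "\<exists>u\<in>L. lform d u \<noteq> 0" if "d \<in> C" for d
        using that unfolding C_def
      proof
        assume "d \<in> c ` R"
        then obtain j where j: "j \<in> R" "d = c j" by auto
        obtain i where "i \<in> R" "i \<noteq> j" using pick[of j] by blast
        then obtain u where "u \<in> L" "lform (c j) u = 1" using val j(1) by blast
        then show ?thesis unfolding j(2) by (intro bexI[of _ u]) simp_all
      next
        assume "d \<in> D ` {(i, j). i \<in> R \<and> j \<in> R \<and> i \<noteq> j}"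
        then obtain i j where ij: "i \<in> R" "j \<in> R" "i \<noteq> j" "d = D (i, j)" by auto
        then obtain u where "u \<in> L" "lform (c i) u = 0" "lform (c j) u = 1" using val by blast
        moreover have "lform (c i) v \<noteq> 0" using False ij by blast
        ultimately show ?thesis
          unfolding ij(4) by (intro bexI[of _ u]) (simp_all add: D_def lform_coeff_diff lform_coeff_scale)
      qed
      then obtain b where b: "b \<in> L" "\<And>d. d \<in> C \<Longrightarrow> lform d b \<noteq> 0"
        using lforms_common_nonzero[OF \<open>finite C\<close> L] by blast
      have b1: "lform (c i) b \<noteq> 0" if "i \<in> R" for i
        using b(2) that unfolding C_def by blast
      have b2: "lform (c i) v * lform (c j) b \<noteq> lform (c j) v * lform (c i) b"
        if "i \<in> R" "j \<in> R" "i \<noteq> j" for i j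
      proof -
        have "D (i, j) \<in> C" using that unfolding C_def by blast
        then show ?thesis
          using b(2)[of "D (i, j)"] by (simp add: D_def lform_coeff_diff lform_coeff_scale)
      qed
      obtain i0 where i0: "i0 \<in> R" using pick by blast
      obtain i1 where i1: "i1 \<in> R" "i1 \<noteq> i0" using pick by blast
      define t where "t i = - lform (c i) v / lform (c i) b" for i
      have "inj_on t R"
      proof (rule inj_onI, rule ccontr)
        fix i j assume "i \<in> R" "j \<in> R" "t i = t j" "i \<noteq> j"
        then show False
          using b1[of i] b1[of j] b2[of i j] by (simp add: t_def field_simps)
      qed
      then have "card (t ` R) = m + k + 1"
        using cardR by (simp add: card_image)
      have "s (v + 0 *s b) = 0"
      proof (rule zero_on_line[OF s, of b v "t ` R"])
        show "b \<noteq> 0" using b1[OF i0] by auto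
        \<comment> \<open>A line through the origin would meet all hyperplanes at the same parameter.\<close>
        show "v + z *s b \<noteq> 0" for z
        proof
          assume 0: "v + z *s b = 0"
          have "lform (c i) v = - z * lform (c i) b" for i
            using arg_cong[OF 0, of "lform (c i)"]
            by (simp add: lform_add lform_scale eq_neg_iff_add_eq_0)
          then show False
            using b2[OF i0 i1(1)] i1(2) by auto
        qed
        show "m < card (t ` R)" using \<open>card (t ` R) = m + k + 1\<close> by simp
        show "s (v + z *s b) = 0" if z: "z \<in> t ` R" for z
        proof -
          obtain i where i: "i \<in> R" "z = t i" using z by blast
          show ?thesis
          proof (rule IH[OF i(1)])
            show "lform (c i) (v + z *s b) = 0"
              using b1[OF i(1)] by (simp add: i(2) t_def lform_add lform_scale lform_diff)
            show "lform (c j) (v + z *s b) = 0" if j: "j \<in> S" for j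
            proof -
              have "lform (c j) b = 0" using b(1) j by (simp add: L_def)
              then show ?thesis by (simp add: lform_add lform_scale Suc.prems(3)[OF j])
            qed
          qed
        qed
      qed
      then show ?thesis by simp
    qed
  qed
  have "card {} + (CARD('i) - 1) + 1 = CARD('i)"
    using zero_less_card_finite[where 'a = 'i] by simp
  then show ?thesis
    by (rule claim[OF empty_subsetI]) simp
qed

section \<open>Linear spans of complexified point sets\<close>

definition homogenize :: "real^'n::finite \<Rightarrow> complex^'n option" where
  "homogenize x = (\<chi> j. case j of None \<Rightarrow> 1 | Some i \<Rightarrow> complex_of_real (x $ i))"

definition cone_lift :: "complex^('n option)^('n option) \<Rightarrow> real^'n::finite \<Rightarrow> complex^('n option)" where
  "cone_lift A x = A *v homogenize x"

text \<open>
  The complex subspace over the projective span of \<open>F\<close>.  The index \<open>None\<close> adds one dimension, so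
  affine notions in the chart become linear ones in the cone.
\<close>

definition cone_span :: "complex^('n option)^('n option) \<Rightarrow> (real^'n::finite) set \<Rightarrow> (complex^('n option)) set" where
  "cone_span A F = vec.span (cone_lift A ` F)"

lemma homogenize_None [simp]: "homogenize x $ None = 1"
  and homogenize_Some [simp]: "homogenize x $ Some i = complex_of_real (x $ i)"
  by (simp_all add: homogenize_def)

lemma inj_homogenize: "inj homogenize"
proof (rule injI)
  fix x y :: "real^'n" assume "homogenize x = homogenize y"
  then have "homogenize x $ Some i = homogenize y $ Some i" for i by simp
  then show "x = y" by (simp add: vec_eq_iff)
qed

lemma homogenize_affine_combination:
  assumes "finite T" "sum u T = 1"
  shows "homogenize (\<Sum>x\<in>T. u x *\<^sub>R x) = (\<Sum>x\<in>T. complex_of_real (u x) *s homogenize x)"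
proof -
  have "homogenize (\<Sum>x\<in>T. u x *\<^sub>R x) $ j = (\<Sum>x\<in>T. complex_of_real (u x) *s homogenize x) $ j" for j
  proof (cases j)
    case None
    then show ?thesis using arg_cong[OF assms(2), of complex_of_real] by simp
  qed simp
  then show ?thesis by (simp add: vec_eq_iff)
qed

lemma homogenize_affine_hull:
  assumes "x \<in> affine hull F"
  shows "homogenize x \<in> vec.span (homogenize ` F)"
proof -
  obtain T u where T: "finite T" "T \<subseteq> F" "sum u T = 1" "(\<Sum>v\<in>T. u v *\<^sub>R v) = x"
    using assms unfolding affine_hull_explicit by auto
  have "(\<Sum>v\<in>T. complex_of_real (u v) *s homogenize v) \<in> vec.span (homogenize ` F)"
    using T(2) by (intro vec.span_sum vec.span_scale vec.span_base) auto
  then show ?thesis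
    using homogenize_affine_combination[OF T(1,3)] T(4) by simp
qed

text \<open>
  A complex linear relation among homogenized points has a real and an imaginary part.  The
  coordinate \<open>None\<close> says that the coefficients of each part sum to \<open>0\<close>, so each part is an affine
  relation.
\<close>

lemma independent_homogenize:
  fixes B :: "(real^'n::finite) set"
  assumes "\<not> affine_dependent B"
  shows "vec.independent (homogenize ` B)"
proof (rule vec.independent_if_scalars_zero)
  have fin: "finite B" by (rule aff_independent_finite[OF assms])
  then show "finite (homogenize ` B)" by simp
  fix g y assume sum0: "(\<Sum>y\<in>homogenize ` B. g y *s y) = 0" and y: "y \<in> homogenize ` B"
  have sum0': "(\<Sum>x\<in>B. g (homogenize x) *s homogenize x) = 0"
    using sum0 by (simp add: sum.reindex inj_on_subset[OF inj_homogenize])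
  \<comment> \<open>Here \<open>r\<close> stands for \<open>Re\<close> or \<open>Im\<close>.\<close>
  have real_part: "\<forall>x\<in>B. r (g (homogenize x)) = 0"
    if r: "\<And>z w. r (z + w) = r z + r w" "\<And>z t. r (z * complex_of_real t) = r z * t" for r :: "complex \<Rightarrow> real"
  proof -
    have r0: "r 0 = 0" using r(1)[of 0 0] by simp
    have r_sum: "r (\<Sum>x\<in>B. f x) = (\<Sum>x\<in>B. r (f x))" for f
      using fin by induction (simp_all add: r(1) r0)
    have "(\<Sum>x\<in>B. g (homogenize x)) = 0"
      using arg_cong[OF sum0', of "\<lambda>v. v $ None"] by simp
    then have "(\<Sum>x\<in>B. r (g (homogenize x))) = 0"
      using r_sum[of "\<lambda>x. g (homogenize x)"] r0 by simp
    moreover have "(\<Sum>x\<in>B. r (g (homogenize x)) *\<^sub>R x) = 0"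
    proof -
      have "(\<Sum>x\<in>B. r (g (homogenize x)) * x $ i) = 0" for i
      proof -
        have "(\<Sum>x\<in>B. g (homogenize x) * complex_of_real (x $ i)) = 0"
          using arg_cong[OF sum0', of "\<lambda>v. v $ Some i"] by simp
        then show ?thesis
          using r_sum[of "\<lambda>x. g (homogenize x) * complex_of_real (x $ i)"] r0 by (simp add: r(2))
      qed
      then show ?thesis by (simp add: vec_eq_iff)
    qed
    ultimately show ?thesis
      using assms affine_dependent_explicit_finite[OF fin] by metis
  qed
  have "\<forall>x\<in>B. Re (g (homogenize x)) = 0"
    by (rule real_part[of Re]) simp_all
  moreover have "\<forall>x\<in>B. Im (g (homogenize x)) = 0"
    by (rule real_part[of Im]) simp_all
  ultimately show "g y = 0"
    using y by (auto simp: complex_eq_iff)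
qed

lemma cone_span_eq: "cone_span A F = (*v) A ` vec.span (homogenize ` F)"
  unfolding cone_span_def cone_lift_def
  by (simp add: vec.span_image[symmetric] image_image)

lemma cone_span_subspace: "vec.subspace (cone_span A F)"
  by (simp add: cone_span_def)

lemma cone_lift_mem_cone_span: "x \<in> F \<Longrightarrow> cone_lift A x \<in> cone_span A F"
  by (simp add: cone_span_def vec.span_base)

lemma cone_lift_nonzero:
  assumes "invertible A"
  shows "cone_lift A x \<noteq> 0"
proof
  assume "cone_lift A x = 0"
  then have "A *v homogenize x = A *v 0" by (simp add: cone_lift_def)
  then have "homogenize x = 0" using inj_matrix_vector_mult[OF assms] by (simp only: inj_eq)
  then have "homogenize x $ None = 0" by simp
  then show False by simp
qed

lemma dim_cone_span:
  fixes F :: "(real^'n::finite) set"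
  assumes "invertible A"
  shows "int (vec.dim (cone_span A F)) = aff_dim F + 1"
proof -
  obtain B where B: "affine hull B = affine hull F" "\<not> affine_dependent B" "int (card B) = aff_dim F + 1"
    using aff_dim_basis_exists[of F] by auto
  have "homogenize ` X \<subseteq> vec.span (homogenize ` Y)" if "affine hull X = affine hull Y"
    for X Y :: "(real^'n) set"
    using that homogenize_affine_hull hull_subset[of X affine] by blast
  then have "vec.span (homogenize ` F) = vec.span (homogenize ` B)"
    using B(1) by (metis vec.span_eq)
  then have "vec.dim (homogenize ` F) = card (homogenize ` B)"
    using independent_homogenize[OF B(2)] by (metis vec.dim_eq_card)
  also have "card (homogenize ` B) = card B"
    by (intro card_image inj_on_subset[OF inj_homogenize]) simp
  finally have "vec.dim (vec.span (homogenize ` F)) = card B"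
    by simp
  moreover have "vec.dim (cone_span A F) = vec.dim (vec.span (homogenize ` F))"
    unfolding cone_span_eq
    by (intro vec.dim_image_eq inj_on_subset[OF inj_matrix_vector_mult[OF assms]] matrix_vector_mul_linear_gen) simp
  ultimately show ?thesis using B(3) by simp
qed

text \<open>
  Membership is detected by dimension: adding \<open>x\<close> to \<open>F\<close> enlarges neither the complex span nor,
  therefore, the affine dimension.
\<close>

lemma cone_lift_mem_cone_span_iff:
  fixes F :: "(real^'n::finite) set"
  assumes A: "invertible A"
  shows "cone_lift A x \<in> cone_span A F \<longleftrightarrow> x \<in> affine hull F"
proof
  assume "x \<in> affine hull F"
  then show "cone_lift A x \<in> cone_span A F"
    using homogenize_affine_hull by (auto simp: cone_span_eq cone_lift_def)
next
  assume "cone_lift A x \<in> cone_span A F"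
  then have "cone_span A (insert x F) = cone_span A F"
    unfolding cone_span_def by (simp add: vec.span_redundant)
  then have "aff_dim (insert x F) = aff_dim F"
    using dim_cone_span[OF A, of F] dim_cone_span[OF A, of "insert x F"] by simp
  then show "x \<in> affine hull F"
    by (metis aff_dim_insert add_cancel_left_right zero_neq_one)
qed

section \<open>Zariski closures of faces\<close>

definition closed_face :: "complex^('n option)^('n option) \<Rightarrow> (real^'n::finite) set \<Rightarrow> 'n option proj set" where
  "closed_face A F = zariski_closure (affine_chart A ` F)"

lemma affine_chart_eq: "affine_chart A x = proj_point (cone_lift A x)"
  by (simp add: affine_chart_def cone_lift_def homogenize_def)

lemma line_of_affine_chart: "invertible A \<Longrightarrow> line_of (affine_chart A x) = vec.span {cone_lift A x}"
  by (simp add: affine_chart_eq line_of_proj_point cone_lift_nonzero)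

lemma closed_face_superset: "affine_chart A ` F \<subseteq> closed_face A F"
  by (auto simp: closed_face_def zariski_closure_def)

text \<open>
  Linear spaces are Zariski closed, so passing to the closure does not affect whether a face lies
  in one.  Everything needed about closed faces follows from this.
\<close>

lemma closed_face_subset_iff:
  assumes A: "invertible A" and W: "vec.subspace W"
  shows "closed_face A F \<subseteq> {p. line_of p \<subseteq> W} \<longleftrightarrow> cone_lift A ` F \<subseteq> W"
proof
  assume L: "closed_face A F \<subseteq> {p. line_of p \<subseteq> W}"
  show "cone_lift A ` F \<subseteq> W"
  proof safe
    fix x assume "x \<in> F"
    then have "line_of (affine_chart A x) \<subseteq> W"
      using closed_face_superset[of A F] L by blast
    then show "cone_lift A x \<in> W"
      using vec.span_base[of "cone_lift A x" "{cone_lift A x}"] by (auto simp: line_of_affine_chart[OF A])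
  qed
next
  assume L: "cone_lift A ` F \<subseteq> W"
  have "line_of (affine_chart A x) \<subseteq> W" if "x \<in> F" for x
    unfolding line_of_affine_chart[OF A] using L that by (intro vec.span_minimal W) auto
  then show "closed_face A F \<subseteq> {p. line_of p \<subseteq> W}"
    unfolding closed_face_def zariski_closure_def
    using zariski_closed_linear_space[OF W] by blast
qed

lemma span_closed_face:
  assumes A: "invertible A"
  shows "vec.span (\<Union>q\<in>closed_face A F. line_of q) = cone_span A F"
proof
  have "closed_face A F \<subseteq> {p. line_of p \<subseteq> cone_span A F}"
    using closed_face_subset_iff[OF A cone_span_subspace, of F A F] cone_lift_mem_cone_span by blast
  then show "vec.span (\<Union>q\<in>closed_face A F. line_of q) \<subseteq> cone_span A F"
    by (intro vec.span_minimal cone_span_subspace) auto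
  have "closed_face A F \<subseteq> {p. line_of p \<subseteq> vec.span (\<Union>q\<in>closed_face A F. line_of q)}"
    using vec.span_superset by fastforce
  then have "cone_lift A ` F \<subseteq> vec.span (\<Union>q\<in>closed_face A F. line_of q)"
    using closed_face_subset_iff[OF A vec.subspace_span] by blast
  then show "cone_span A F \<subseteq> vec.span (\<Union>q\<in>closed_face A F. line_of q)"
    unfolding cone_span_def by (intro vec.span_minimal vec.subspace_span)
qed

lemma proj_dim_closed_face:
  assumes "invertible A"
  shows "proj_dim (closed_face A F) = aff_dim F"
  using dim_cone_span[OF assms, of F]
  unfolding proj_dim_def span_closed_face[OF assms, symmetric] by simp

lemma proj_span_closed_face:
  assumes "invertible A"
  shows "proj_span (closed_face A F) = {p. line_of p \<subseteq> cone_span A F}"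
  by (simp add: proj_span_def span_closed_face[OF assms])

lemma face_determined_by_cone_span:
  assumes A: "invertible A" and "convex Q" "F face_of Q" "G face_of Q"
    and eq: "cone_span A F = cone_span A G"
  shows "F = G"
proof -
  have "affine hull F = affine hull G"
    using cone_lift_mem_cone_span_iff[OF A] eq by blast
  then show ?thesis
    using assms face_of_imp_eq_affine_Int by metis
qed

section \<open>Facets through a vertex\<close>

text \<open>
  A vertex is the intersection of the facets that contain it.
\<close>

lemma facet_separating_vertices:
  fixes Q :: "'a::euclidean_space set"
  assumes Q: "polytope Q" and "v extreme_point_of Q" "w extreme_point_of Q" "v \<noteq> w"
  obtains F where "F facet_of Q" "w \<in> F" "v \<notin> F"
proof -
  have "{w} face_of Q" using assms by (simp add: face_of_singleton)
  moreover have "{w} \<noteq> Q"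
    using assms extreme_point_of_def by blast
  ultimately have "{w} = \<Inter>{F. F facet_of Q \<and> {w} \<subseteq> F}"
    using Q by (intro face_of_polyhedron polytope_imp_polyhedron) auto
  then have "v \<notin> \<Inter>{F. F facet_of Q \<and> {w} \<subseteq> F}" using \<open>v \<noteq> w\<close> by auto
  then show ?thesis using that by blast
qed

lemma another_extreme_point:
  fixes Q :: "'a::euclidean_space set"
  assumes "polytope Q" "aff_dim Q > 0"
  obtains w where "w extreme_point_of Q" "w \<noteq> v"
proof (rule ccontr)
  assume "\<not> thesis"
  then have "{w. w extreme_point_of Q} \<subseteq> {v}" using that by blast
  then have "convex hull {w. w extreme_point_of Q} \<subseteq> {v}"
    using hull_mono[of _ "{v}" convex] by auto
  moreover have "Q = convex hull {w. w extreme_point_of Q}"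
    using assms by (intro Krein_Milman_Minkowski polytope_imp_compact polytope_imp_convex)
  ultimately have "Q \<subseteq> {v}" by simp
  then show False using aff_dim_subset[of Q "{v}"] assms(2) by simp
qed

text \<open>
  With fewer facets than dimensions there is a direction \<open>u \<noteq> 0\<close> parallel to all facets through
  \<open>v\<close>.  The other inequalities that define \<open>Q\<close> are strict at \<open>v\<close>, so \<open>v + e u\<close> and \<open>v - e u\<close> both lie in
  \<open>Q\<close> for small \<open>e > 0\<close>, which contradicts extremality.
\<close>

lemma facets_through_vertex_lower_bound:
  fixes Q :: "'a::euclidean_space set"
  assumes Q: "polytope Q" and dim: "aff_dim Q = int DIM('a)" and v: "v extreme_point_of Q"
  shows "DIM('a) \<le> card {F. F facet_of Q \<and> v \<in> F}"
proof (rule ccontr)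
  let ?\<F> = "{F. F facet_of Q \<and> v \<in> F}"
  assume "\<not> ?thesis"
  then have few: "card ?\<F> < DIM('a)" by simp
  have fin: "finite ?\<F>" using finite_polytope_facets[OF Q] by simp
  have "affine hull Q = UNIV" using dim by (simp add: aff_dim_eq_full)
  obtain H where H: "finite H" "Q = affine hull Q \<inter> \<Inter>H"
    "\<forall>h\<in>H. \<exists>a b. a \<noteq> 0 \<and> h = {x. a \<bullet> x \<le> b}"
    "\<forall>H'. H' \<subset> H \<longrightarrow> Q \<subset> affine hull Q \<inter> \<Inter>H'"
    using polytope_imp_polyhedron[OF Q] unfolding polyhedron_Int_affine_minimal by blast
  obtain a b where ab: "\<And>h. h \<in> H \<Longrightarrow> a h \<noteq> 0 \<and> h = {x. a h \<bullet> x \<le> b h}"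
    using H(3) by metis
  have facet_iff: "F facet_of Q \<longleftrightarrow> (\<exists>h. h \<in> H \<and> F = Q \<inter> {x. a h \<bullet> x = b h})" for F
    by (rule facet_of_polyhedron_explicit[OF H(1,2) ab]) (use H(4) in auto)
  have Q_eq: "Q = {x. \<forall>h\<in>H. a h \<bullet> x \<le> b h}"
    using H(2) ab \<open>affine hull Q = UNIV\<close> by blast
  have facet_hull: "affine hull (Q \<inter> {x. a h \<bullet> x = b h}) = {x. a h \<bullet> x = b h}"
    if h: "h \<in> H" for h
  proof (rule affine_dim_equal)
    have "(Q \<inter> {x. a h \<bullet> x = b h}) facet_of Q" using facet_iff h by blast
    then have F: "aff_dim (Q \<inter> {x. a h \<bullet> x = b h}) = int DIM('a) - 1" "Q \<inter> {x. a h \<bullet> x = b h} \<noteq> {}"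
      using dim by (auto simp: facet_of_def)
    show "affine hull (Q \<inter> {x. a h \<bullet> x = b h}) \<noteq> {}" using F(2) by simp
    show "affine hull (Q \<inter> {x. a h \<bullet> x = b h}) \<subseteq> {x. a h \<bullet> x = b h}"
      by (intro hull_minimal affine_hyperplane) auto
    show "aff_dim (affine hull (Q \<inter> {x. a h \<bullet> x = b h})) = aff_dim {x. a h \<bullet> x = b h}"
      using F(1) ab[OF h] by (simp add: aff_dim_hyperplane)
  qed (simp_all add: affine_hyperplane)
  define h where "h F = (SOME h. h \<in> H \<and> F = Q \<inter> {x. a h \<bullet> x = b h})" for F
  have h: "h F \<in> H" "F = Q \<inter> {x. a (h F) \<bullet> x = b (h F)}" if "F facet_of Q" for F
    using someI_ex[OF facet_iff[THEN iffD1, OF that]] unfolding h_def by blast+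
  have "dim ((\<lambda>F. a (h F)) ` ?\<F>) \<le> card ((\<lambda>F. a (h F)) ` ?\<F>)"
    using fin by (intro dim_le_card') simp
  also have "\<dots> \<le> card ?\<F>" using fin by (rule card_image_le)
  finally have "dim ((\<lambda>F. a (h F)) ` ?\<F>) < DIM('a)" using few by simp
  then obtain u where u: "u \<noteq> 0" "\<And>y. y \<in> span ((\<lambda>F. a (h F)) ` ?\<F>) \<Longrightarrow> orthogonal u y"
    using orthogonal_to_subspace_exists by blast
  have vQ: "v \<in> Q" using v by (simp add: extreme_point_of_def)
  \<comment> \<open>The form chosen for a facet need not be \<open>a k\<close>, but both define its affine hull.\<close>
  have tight: "a k \<bullet> u = 0" if k: "k \<in> H" "a k \<bullet> v = b k" for k
  proof -
    let ?F = "Q \<inter> {x. a k \<bullet> x = b k}"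
    have F: "?F facet_of Q" "v \<in> ?F" using facet_iff k vQ by auto
    define k' where "k' = h ?F"
    have k': "k' \<in> H" "?F = Q \<inter> {x. a k' \<bullet> x = b k'}"
      unfolding k'_def by (rule h(1)[OF F(1)], rule h(2)[OF F(1)])
    have "a k' \<in> (\<lambda>F. a (h F)) ` ?\<F>"
      unfolding k'_def using F by (intro imageI) simp
    then have "a k' \<bullet> u = 0"
      using u(2) by (metis orthogonal_def inner_commute span_base)
    moreover have "a k' \<bullet> v = b k'" using F(2) k'(2) by blast
    ultimately have "v + u \<in> {x. a k' \<bullet> x = b k'}"
      by (simp add: inner_add_right)
    then have "v + u \<in> affine hull ?F"
      unfolding k'(2) facet_hull[OF k'(1)] .
    then have "v + u \<in> {x. a k \<bullet> x = b k}"
      unfolding facet_hull[OF k(1)] .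
    then have "a k \<bullet> (v + u) = b k"
      by simp
    then show ?thesis using k by (simp add: inner_add_right)
  qed
  have "\<forall>\<^sub>F e in at_right (0::real). \<forall>k\<in>H. a k \<bullet> (v + e *\<^sub>R u) \<le> b k \<and> a k \<bullet> (v - e *\<^sub>R u) \<le> b k"
  proof (rule eventually_ball_finite[OF H(1)], rule ballI)
    fix k assume k: "k \<in> H"
    show "\<forall>\<^sub>F e in at_right (0::real). a k \<bullet> (v + e *\<^sub>R u) \<le> b k \<and> a k \<bullet> (v - e *\<^sub>R u) \<le> b k"
    proof (cases "a k \<bullet> v = b k")
      case True
      then show ?thesis using tight[OF k] by (simp add: inner_add_right inner_diff_right)
    next
      case False
      then have less: "a k \<bullet> v < b k" using vQ k Q_eq by force
      have "((\<lambda>e. a k \<bullet> (v + e *\<^sub>R u)) \<longlongrightarrow> a k \<bullet> (v + 0 *\<^sub>R u)) (at_right 0)"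
        "((\<lambda>e. a k \<bullet> (v - e *\<^sub>R u)) \<longlongrightarrow> a k \<bullet> (v - 0 *\<^sub>R u)) (at_right 0)"
        by (intro tendsto_intros)+
      then have "\<forall>\<^sub>F e in at_right 0. a k \<bullet> (v + e *\<^sub>R u) < b k"
        "\<forall>\<^sub>F e in at_right 0. a k \<bullet> (v - e *\<^sub>R u) < b k"
        using less by (auto intro: order_tendstoD(2))
      then show ?thesis by eventually_elim simp
    qed
  qed
  moreover have "\<forall>\<^sub>F e in at_right (0::real). e > 0"
    by (rule eventually_at_right_less)
  ultimately have "\<forall>\<^sub>F e in at_right (0::real). v + e *\<^sub>R u \<in> Q \<and> v - e *\<^sub>R u \<in> Q \<and> e > 0"
    by eventually_elim (auto simp: Q_eq)
  then obtain e :: real where e: "v + e *\<^sub>R u \<in> Q" "v - e *\<^sub>R u \<in> Q" "e > 0"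
    using eventually_happens'[of "at_right (0::real)"] by fastforce
  have "midpoint (v + e *\<^sub>R u) (v - e *\<^sub>R u) = v"
    by (simp add: midpoint_eq_iff)
  moreover have "v + e *\<^sub>R u \<noteq> v - e *\<^sub>R u"
  proof
    assume "v + e *\<^sub>R u = v - e *\<^sub>R u"
    then have "e *\<^sub>R u = - (e *\<^sub>R u)" by simp
    then have "2 *\<^sub>R (e *\<^sub>R u) = 0" unfolding scaleR_2 by (simp only: eq_neg_iff_add_eq_0)
    then show False using e u by simp
  qed
  ultimately have "v \<in> open_segment (v + e *\<^sub>R u) (v - e *\<^sub>R u)"
    by (metis midpoint_in_open_segment)
  then show False using v e unfolding extreme_point_of_def by blast
qed

section \<open>Wachspress forms\<close>

lemma sum_fun_apply: "(\<Sum>i\<in>I. f i) x = (\<Sum>i\<in>I. f i x :: complex)"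
  by (induction I rule: infinite_finite_induct) auto

text \<open>
  A full-dimensional polytope in a chart, together with a linear form for each facet hyperplane.
  Simplicity of the arrangement is expressed as general position of these forms.
\<close>

locale simple_polytope =
  fixes A :: "complex^('n::finite option)^('n option)" and Q :: "(real^'n) set"
    and c :: "(real^'n) set \<Rightarrow> complex^('n option)"
  assumes invertible_A: "invertible A"
    and polytope_Q: "polytope Q"
    and full_dim: "aff_dim Q = int CARD('n)"
    and facet_form: "\<And>F u. F facet_of Q \<Longrightarrow> lform (c F) u = 0 \<longleftrightarrow> u \<in> cone_span A F"
    and general: "general_position c {F. F facet_of Q}"
begin

abbreviation "facets_at v \<equiv> {F. F facet_of Q \<and> v \<in> F}"
abbreviation "facets_off v \<equiv> {F. F facet_of Q \<and> v \<notin> F}"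
abbreviation "extreme_points \<equiv> {v. v extreme_point_of Q}"

definition wachspress :: "real^'n \<Rightarrow> complex^('n option) \<Rightarrow> complex" where
  "wachspress v u = (\<Prod>F\<in>facets_off v. lform (c F) u)"

lemma finite_facets: "finite {F. F facet_of Q}"
  by (rule finite_polytope_facets[OF polytope_Q])

lemma finite_facets_at: "finite (facets_at v)"
  by (rule finite_subset[OF _ finite_facets]) blast

lemma finite_facets_off: "finite (facets_off v)"
  by (rule finite_subset[OF _ finite_facets]) blast

lemma finite_extreme_points: "finite extreme_points"
  by (rule finite_polyhedron_extreme_points[OF polytope_imp_polyhedron[OF polytope_Q]])

lemma facet_form_lift:
  assumes "F facet_of Q" "x \<in> Q"
  shows "lform (c F) (cone_lift A x) = 0 \<longleftrightarrow> x \<in> F"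
proof -
  have "F = affine hull F \<inter> Q"
    using assms(1) polytope_imp_convex[OF polytope_Q]
    by (intro face_of_imp_eq_affine_Int) (auto simp: facet_of_def)
  then have "x \<in> affine hull F \<longleftrightarrow> x \<in> F" using assms(2) by blast
  then show ?thesis
    by (simp add: facet_form[OF assms(1)] cone_lift_mem_cone_span_iff[OF invertible_A])
qed

text \<open>
  A second vertex lies on a facet that misses the first one.
\<close>

lemma facets_off_nonempty:
  assumes "v extreme_point_of Q"
  shows "facets_off v \<noteq> {}"
proof -
  have "aff_dim Q > 0" using full_dim by simp
  then obtain w where "w extreme_point_of Q" "w \<noteq> v"
    using another_extreme_point[OF polytope_Q] by blast
  then obtain F where "F facet_of Q" "v \<notin> F"
    using facet_separating_vertices[OF polytope_Q assms] by metis
  then show ?thesis by blast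
qed

text \<open>
  The lower bound holds for all polytopes.  The upper bound is general position at the vertex.
\<close>

lemma card_facets_at:
  assumes v: "v extreme_point_of Q"
  shows "card (facets_at v) = CARD('n)"
proof (rule antisym)
  show "CARD('n) \<le> card (facets_at v)"
    using facets_through_vertex_lower_bound[OF polytope_Q _ v] full_dim by simp
  show "card (facets_at v) \<le> CARD('n)"
  proof (rule ccontr)
    assume "\<not> ?thesis"
    then have "Suc CARD('n) \<le> card (facets_at v)" by simp
    then obtain T where T: "T \<subseteq> facets_at v" "card T = Suc CARD('n)"
      by (rule obtain_subset_with_card_n)
    have "v \<in> Q" using v by (simp add: extreme_point_of_def)
    then have "lform (c F) (cone_lift A v) = 0" if "F \<in> T" for F
      using that T(1) facet_form_lift[of F v] by blast
    moreover have "T \<subseteq> {F. F facet_of Q}" "card T = CARD('n option)" using T by auto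
    ultimately have "cone_lift A v = 0"
      using general_positionD[OF general, of T] by blast
    then show False using cone_lift_nonzero[OF invertible_A] by blast
  qed
qed

lemma card_facets_split:
  assumes v: "v extreme_point_of Q"
  shows "card {F. F facet_of Q} = CARD('n) + card (facets_off v)"
proof -
  have "{F. F facet_of Q} = facets_at v \<union> facets_off v" by blast
  moreover have "card (facets_at v \<union> facets_off v) = card (facets_at v) + card (facets_off v)"
    by (rule card_Un_disjoint[OF finite_facets_at finite_facets_off]) blast
  ultimately show ?thesis
    by (simp only: card_facets_at[OF v])
qed

lemma exists_extreme_point: "\<exists>v. v extreme_point_of Q"
proof -
  have "aff_dim Q > 0" using full_dim by simp
  then show ?thesis
    using another_extreme_point[OF polytope_Q] by blast
qed

text \<open>
  The twist \<open>d - n\<close> and common degree of the Wachspress forms.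
\<close>

definition excess :: nat where
  "excess = card {F. F facet_of Q} - CARD('n)"

lemma card_facets_off: "v extreme_point_of Q \<Longrightarrow> card (facets_off v) = excess"
  using card_facets_split[of v] by (simp add: excess_def)

lemma card_facets: "card {F. F facet_of Q} = CARD('n) + excess"
proof -
  obtain v where v: "v extreme_point_of Q" using exists_extreme_point by blast
  show ?thesis using card_facets_split[OF v] by (simp add: excess_def)
qed

lemma excess_pos: "excess > 0"
proof -
  obtain v where v: "v extreme_point_of Q" using exists_extreme_point by blast
  have "card (facets_off v) > 0"
    using facets_off_nonempty[OF v] finite_facets_off by (simp add: card_gt_0_iff)
  then show ?thesis by (simp add: card_facets_off[OF v])
qed

lemma wachspress_in_forms:
  assumes "v extreme_point_of Q"
  shows "wachspress v \<in> forms excess"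
proof -
  have "(\<lambda>u. \<Prod>F\<in>facets_off v. lform (c F) u) \<in> forms (card (facets_off v))"
    by (rule prod_lforms_in_forms[OF finite_facets_off])
  then show ?thesis
    by (simp add: wachspress_def[abs_def] card_facets_off[OF assms])
qed

lemma wachspress_eq_0:
  assumes "F facet_of Q" "v \<notin> F" "lform (c F) u = 0"
  shows "wachspress v u = 0"
  unfolding wachspress_def
  unfolding prod_zero_iff[OF finite_facets_off] using assms by blast

text \<open>
  Vertices and Wachspress forms are dual to each other, up to nonzero factors.
\<close>

lemma wachspress_lift:
  assumes v: "v extreme_point_of Q" and w: "w extreme_point_of Q"
  shows "wachspress v (cone_lift A w) = 0 \<longleftrightarrow> v \<noteq> w"
proof
  have "w \<in> Q" using w by (simp add: extreme_point_of_def)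
  show "wachspress v (cone_lift A w) = 0" if ne: "v \<noteq> w"
  proof -
    obtain F where "F facet_of Q" "w \<in> F" "v \<notin> F"
      using facet_separating_vertices[OF polytope_Q v w ne] by blast
    then show ?thesis
      using wachspress_eq_0[of F v] facet_form_lift[of F w] \<open>w \<in> Q\<close> by blast
  qed
  show "v \<noteq> w" if 0: "wachspress v (cone_lift A w) = 0"
  proof
    assume "v = w"
    obtain F where "F facet_of Q" "v \<notin> F" "lform (c F) (cone_lift A w) = 0"
      using 0 unfolding wachspress_def prod_zero_iff[OF finite_facets_off] by blast
    then show False
      using facet_form_lift[of F w] \<open>w \<in> Q\<close> \<open>v = w\<close> by blast
  qed
qed

text \<open>
  The hyperplanes of the facets through \<open>v\<close> meet only in \<open>v\<close>: subtracting a multiple of the lift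
  of \<open>v\<close> kills one further form, and general position applies.
\<close>

lemma common_zero_of_facets_at:
  assumes v: "v extreme_point_of Q" and S: "S \<subseteq> {F. F facet_of Q}" "card S = CARD('n)" "\<forall>F\<in>S. v \<in> F"
    and u: "\<And>F. F \<in> S \<Longrightarrow> lform (c F) u = 0"
  obtains t where "u = t *s cone_lift A v"
proof -
  have vQ: "v \<in> Q" using v by (simp add: extreme_point_of_def)
  have finS: "finite S" using finite_subset[OF S(1) finite_facets] .
  obtain G where G: "G facet_of Q" "v \<notin> G" using facets_off_nonempty[OF v] by auto
  then have Gv: "lform (c G) (cone_lift A v) \<noteq> 0" using facet_form_lift[of G v] vQ by blast
  define t where "t = lform (c G) u / lform (c G) (cone_lift A v)"
  have zero: "lform (c F) (u - t *s cone_lift A v) = 0" if "F \<in> insert G S" for F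
  proof (cases "F = G")
    case True
    then show ?thesis using Gv by (simp add: lform_diff lform_scale t_def)
  next
    case False
    then have "F \<in> S" using that by simp
    then have "lform (c F) (cone_lift A v) = 0" using facet_form_lift[of F v] S vQ by blast
    then show ?thesis using u[OF \<open>F \<in> S\<close>] by (simp add: lform_diff lform_scale)
  qed
  have "G \<notin> S" using G S(3) by blast
  then have "card (insert G S) = CARD('n option)" using finS S(2) by simp
  moreover have "insert G S \<subseteq> {F. F facet_of Q}" using G S(1) by blast
  ultimately have "u - t *s cone_lift A v = 0"
    using general_positionD[OF general, of "insert G S"] zero by blast
  then show ?thesis using that[of t] by simp
qed

text \<open>
  The residual arrangement in terms of the facet forms.  A linear space that contains a face
  contains a vertex of it, so it is enough to exclude the vertices.
\<close>

definition residual :: "'n option proj set" where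
  "residual = {p. \<exists>S \<subseteq> {F. F facet_of Q}.
     (\<forall>F\<in>S. \<forall>u\<in>line_of p. lform (c F) u = 0) \<and> (\<forall>v. v extreme_point_of Q \<longrightarrow> (\<exists>F\<in>S. v \<notin> F))}"

definition residual_sections :: "(complex^('n option) \<Rightarrow> complex) set" where
  "residual_sections = {s \<in> twisting_sheaf (int excess) UNIV. \<forall>p\<in>residual. \<forall>u\<in>line_of p - {0}. s u = 0}"

lemma wachspress_in_residual_sections:
  assumes v: "v extreme_point_of Q"
  shows "wachspress v \<in> residual_sections"
proof -
  have "wachspress v u = 0" if p: "p \<in> residual" and u: "u \<in> line_of p" for p u
  proof -
    obtain S where "S \<subseteq> {F. F facet_of Q}" "\<forall>F\<in>S. \<forall>u\<in>line_of p. lform (c F) u = 0" "\<exists>F\<in>S. v \<notin> F"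
      using p v unfolding residual_def by blast
    then obtain F where "F facet_of Q" "v \<notin> F" "lform (c F) u = 0"
      using u by blast
    then show ?thesis by (rule wachspress_eq_0)
  qed
  then show ?thesis
    using form_is_global_section[OF wachspress_in_forms[OF v] excess_pos]
    by (simp add: residual_sections_def)
qed

text \<open>
  The difference of the two sides vanishes at all \<open>n\<close>-fold intersections of facet hyperplanes:
  at a vertex by the choice of the coefficients, and elsewhere because the point is residual.
\<close>

lemma residual_section_eq_combination:
  assumes s: "s \<in> residual_sections"
  shows "s u = (\<Sum>v\<in>extreme_points. s (cone_lift A v) / wachspress v (cone_lift A v) * wachspress v u)"
proof -
  define a where "a v = s (cone_lift A v) / wachspress v (cone_lift A v)" for v
  define r where "r u = s u - (\<Sum>v\<in>extreme_points. a v * wachspress v u)" for u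
  have s_sheaf: "s \<in> twisting_sheaf (int excess) UNIV"
    using s by (simp add: residual_sections_def)
  have "polynomial_on_lines excess (wachspress v)" if "v \<in> extreme_points" for v
    using that wachspress_in_residual_sections section_polynomial_on_lines
    unfolding residual_sections_def by blast
  then have r_lines: "polynomial_on_lines excess r"
    unfolding r_def[abs_def]
    by (intro polynomial_on_lines_diff polynomial_on_lines_sum polynomial_on_lines_scale
        section_polynomial_on_lines[OF s_sheaf] finite_extreme_points)
  have zero: "r u = 0"
    if S: "S \<subseteq> {F. F facet_of Q}" "card S + 1 = CARD('n option)"
      and u: "\<And>F. F \<in> S \<Longrightarrow> lform (c F) u = 0" for S u
  proof (cases "u = 0")
    case True
    have "wachspress v 0 = 0" if "v \<in> extreme_points" for v
      using that forms_scale[OF wachspress_in_forms, of v 0 0] excess_pos by (simp add: zero_power)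
    then show ?thesis
      using True section_at_zero[OF s_sheaf] by (simp add: r_def)
  next
    case False
    show ?thesis
    proof (cases "\<exists>v. v extreme_point_of Q \<and> (\<forall>F\<in>S. v \<in> F)")
      case True
      then obtain v where v: "v extreme_point_of Q" "\<forall>F\<in>S. v \<in> F" by blast
      obtain t where t: "u = t *s cone_lift A v"
        using common_zero_of_facets_at[OF v(1) S(1) _ v(2) u] S(2) by auto
      then have "t \<noteq> 0" using False by auto
      have w: "wachspress x u = t ^ excess * wachspress x (cone_lift A v)" if "x \<in> extreme_points" for x
        using that forms_scale[OF wachspress_in_forms] unfolding t by blast
      have "(\<Sum>x\<in>extreme_points. a x * wachspress x u) = (\<Sum>x\<in>{v}. a x * wachspress x u)"
        by (rule sum.mono_neutral_right)
           (use v(1) finite_extreme_points w wachspress_lift[OF _ v(1)] in auto)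
      also have "\<dots> = t ^ excess * s (cone_lift A v)"
        using v(1) wachspress_lift[OF v(1) v(1)] by (simp add: w a_def)
      also have "\<dots> = s u"
        unfolding t by (rule section_scale[OF s_sheaf \<open>t \<noteq> 0\<close>, symmetric])
      finally show ?thesis by (simp add: r_def)
    next
      case no_vertex: False
      have "lform (c F) x = 0" if "F \<in> S" "x \<in> line_of (proj_point u)" for F x
        using that u[OF that(1)] False
        by (auto simp: line_of_proj_point vec.span_singleton lform_scale)
      then have "proj_point u \<in> residual"
        using no_vertex S(1) unfolding residual_def mem_Collect_eq by (intro exI[of _ S]) auto
      moreover have "u \<in> line_of (proj_point u) - {0}"
        using False mem_line_of_proj_point by blast
      ultimately have vanish: "f u = 0" if "f \<in> residual_sections" for f
        using that unfolding residual_sections_def by blast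
      have "(\<Sum>v\<in>extreme_points. a v * wachspress v u) = 0"
        by (intro sum.neutral ballI) (simp add: vanish wachspress_in_residual_sections)
      then show ?thesis
        using vanish[OF s] by (simp add: r_def)
    qed
  qed
  have "r u = 0"
    by (rule zero_if_zero_on_star_configuration[OF general finite_facets _ excess_pos r_lines zero])
       (simp_all add: card_facets)
  then show ?thesis by (simp add: r_def a_def)
qed

lemma dim_residual_sections: "cfun.dim residual_sections = card extreme_points"
proof -
  have inj: "inj_on wachspress extreme_points"
    by (rule inj_onI) (metis wachspress_lift mem_Collect_eq)
  let ?B = "wachspress ` extreme_points"
  have "cfun.independent ?B"
  proof (rule cfun.independent_if_scalars_zero)
    show "finite ?B" using finite_extreme_points by simp
    fix g f assume 0: "(\<Sum>f\<in>?B. (\<lambda>u. g f * f u)) = 0" and "f \<in> ?B"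
    then obtain v where v: "v extreme_point_of Q" "f = wachspress v" by blast
    have "(\<Sum>x\<in>extreme_points. g (wachspress x) * wachspress x (cone_lift A v)) = 0"
      using fun_cong[OF 0, of "cone_lift A v"] by (simp add: sum.reindex[OF inj] sum_fun_apply)
    moreover have "(\<Sum>x\<in>extreme_points. g (wachspress x) * wachspress x (cone_lift A v)) =
        (\<Sum>x\<in>{v}. g (wachspress x) * wachspress x (cone_lift A v))"
      by (rule sum.mono_neutral_right)
         (use v(1) finite_extreme_points wachspress_lift[OF _ v(1)] in auto)
    ultimately show "g f = 0"
      using wachspress_lift[OF v(1) v(1)] v(2) by simp
  qed
  moreover have "cfun.span ?B = cfun.span residual_sections"
    unfolding cfun.span_eq
  proof
    show "?B \<subseteq> cfun.span residual_sections"
      using wachspress_in_residual_sections cfun.span_superset by blast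
    show "residual_sections \<subseteq> cfun.span ?B"
    proof
      fix s assume s: "s \<in> residual_sections"
      have "(\<Sum>v\<in>extreme_points. (\<lambda>u. s (cone_lift A v) / wachspress v (cone_lift A v) * wachspress v u)) \<in> cfun.span ?B"
        by (intro cfun.span_sum cfun.span_scale cfun.span_base imageI)
      moreover have "s = (\<Sum>v\<in>extreme_points. (\<lambda>u. s (cone_lift A v) / wachspress v (cone_lift A v) * wachspress v u))"
        by (rule ext, unfold sum_fun_apply, rule residual_section_eq_combination[OF s])
      ultimately show "s \<in> cfun.span ?B" by (rule ssubst[rotated])
    qed
  qed
  ultimately have "cfun.dim residual_sections = card ?B"
    by (intro cfun.dim_eq_card)
  then show ?thesis using card_image[OF inj] by simp
qed

end

section \<open>From projective polytopes to polytopes in a chart\<close>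

lemma closed_face_subset_hyperplane_iff:
  assumes "invertible A"
  shows "closed_face A F \<subseteq> proj_span (closed_face A G) \<longleftrightarrow> cone_lift A ` F \<subseteq> cone_span A G"
  unfolding proj_span_closed_face[OF assms]
  by (rule closed_face_subset_iff[OF assms cone_span_subspace])

text \<open>
  Hence distinct facets span distinct hyperplanes, and counting hyperplanes through a point is
  counting facets.
\<close>

lemma inj_on_proj_span_closed_face:
  assumes A: "invertible A" and Q: "convex Q"
  shows "inj_on (\<lambda>F. proj_span (closed_face A F)) {F. F face_of Q}"
proof (rule inj_onI)
  fix F G assume FG: "F \<in> {F. F face_of Q}" "G \<in> {F. F face_of Q}"
    and eq: "proj_span (closed_face A F) = proj_span (closed_face A G)"
  have self: "cone_lift A ` F \<subseteq> cone_span A F" for F using cone_lift_mem_cone_span by blast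
  have "cone_lift A ` F \<subseteq> cone_span A G" "cone_lift A ` G \<subseteq> cone_span A F"
    using closed_face_subset_hyperplane_iff[OF A] eq self by metis+
  then have "cone_span A F = cone_span A G"
    unfolding cone_span_def by (metis vec.span_eq)
  then show "F = G"
    using FG face_determined_by_cone_span[OF A Q] by blast
qed

lemma exists_extreme_point_of_face:
  fixes Q :: "'a::euclidean_space set"
  assumes Q: "polytope Q" and F: "F face_of Q" "F \<noteq> {}"
  obtains v where "v extreme_point_of Q" "v \<in> F"
proof -
  have "polytope F" using face_of_polytope_polytope[OF Q F(1)] .
  then obtain v where "v extreme_point_of F"
    using extreme_point_exists_convex[of F] F(2) polytope_imp_compact polytope_imp_convex by blast
  then show ?thesis using that extreme_point_of_face[OF F(1)] by blast
qed

theorem theorem1p11: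
  fixes P :: "'n::finite option proj set set"
  assumes "full_dim_polytope P"
    and "simple_arrangement (hyperplane_arrangement P)"
  shows "cfun.dim (Omega P) = card (vertices P)"
proof -
  obtain A and Q :: "(real^'n) set" where A: "invertible A" and Q: "polytope Q"
    and dimQ: "aff_dim Q = int CARD('n)"
    and P: "P = {closed_face A F | F. F face_of Q \<and> F \<noteq> {}}"
    using assms(1) unfolding full_dim_polytope_def closed_face_def by blast
  let ?H = "\<lambda>F. proj_span (closed_face A F)"
  let ?\<F> = "{F. F facet_of Q}"
  have convQ: "convex Q" using polytope_imp_convex[OF Q] .
  have inj_H: "inj_on ?H {F. F face_of Q}" by (rule inj_on_proj_span_closed_face[OF A convQ])
  then have inj_Z: "inj_on (closed_face A) {F. F face_of Q}"
    by (auto simp: inj_on_def)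
  have facet_face: "?\<F> \<subseteq> {F. F face_of Q}" by (auto simp: facet_of_def)
  have finF: "finite ?\<F>" by (rule finite_polytope_facets[OF Q])
  have facets: "facets P = closed_face A ` ?\<F>"
    unfolding facets_def P facet_of_def by (auto simp: proj_dim_closed_face[OF A] dimQ)
  then have card_facets_P: "card (facets P) = card ?\<F>"
    using card_image[OF inj_on_subset[OF inj_Z facet_face]] by simp
  have arrangement: "hyperplane_arrangement P = ?H ` ?\<F>"
    by (simp add: hyperplane_arrangement_def facets image_image)
  have vertices: "vertices P = (\<lambda>v. closed_face A {v}) ` {v. v extreme_point_of Q}"
    unfolding vertices_def P
    by (auto simp: proj_dim_closed_face[OF A] aff_dim_eq_0 face_of_singleton)
  have "inj_on (\<lambda>v. closed_face A {v}) {v. v extreme_point_of Q}"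
  proof (rule inj_onI)
    fix v w assume "v \<in> {v. v extreme_point_of Q}" "w \<in> {v. v extreme_point_of Q}"
      "closed_face A {v} = closed_face A {w}"
    then have "{v} = {w}"
      by (intro inj_onD[OF inj_Z]) (simp_all add: face_of_singleton)
    then show "v = w" by simp
  qed
  then have card_vertices: "card (vertices P) = card {v. v extreme_point_of Q}"
    by (simp add: vertices card_image)
  have "\<exists>d. \<forall>u. lform d u = 0 \<longleftrightarrow> u \<in> cone_span A F" if "F facet_of Q" for F
  proof -
    have "aff_dim F = int CARD('n) - 1" using that dimQ by (simp add: facet_of_def)
    then have "vec.dim (cone_span A F) + 1 = CARD('n option)"
      using dim_cone_span[OF A, of F] by simp
    then show ?thesis
      using lform_defines_hyperplane[OF cone_span_subspace] by metis
  qed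
  then obtain c where c: "\<And>F u. F facet_of Q \<Longrightarrow> lform (c F) u = 0 \<longleftrightarrow> u \<in> cone_span A F"
    by metis
  have line_in_H: "p \<in> ?H F \<longleftrightarrow> (\<forall>u\<in>line_of p. lform (c F) u = 0)" if "F facet_of Q" for p F
    using c[OF that] by (auto simp: proj_span_closed_face[OF A])
  have "general_position c ?\<F>"
    unfolding general_position_def
  proof (intro allI impI, rule ccontr)
    fix T v assume T: "T \<subseteq> ?\<F>" "card T = CARD('n option)" "\<forall>F\<in>T. lform (c F) v = 0" and v: "v \<noteq> 0"
    have "?H ` T \<subseteq> {H \<in> hyperplane_arrangement P. proj_point v \<in> H}"
    proof safe
      fix F assume "F \<in> T"
      then have F: "F facet_of Q" "lform (c F) v = 0" using T by auto
      then show "?H F \<in> hyperplane_arrangement P" by (simp add: arrangement)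
      show "proj_point v \<in> ?H F"
        unfolding line_in_H[OF F(1)] using F(2) v
        by (auto simp: line_of_proj_point vec.span_singleton lform_scale)
    qed
    moreover have "finite {H \<in> hyperplane_arrangement P. proj_point v \<in> H}"
      using finF by (simp add: arrangement)
    ultimately have "card (?H ` T) \<le> card {H \<in> hyperplane_arrangement P. proj_point v \<in> H}"
      by (rule card_mono[rotated])
    also have "\<dots> \<le> CARD('n)"
      using assms(2) unfolding simple_arrangement_def by blast
    also have "card (?H ` T) = CARD('n option)"
      using T facet_face by (simp add: card_image inj_on_subset[OF inj_H])
    finally show False by simp
  qed
  then interpret simple_polytope A Q c
    using A Q dimQ c by unfold_locales
  have vertex_in_H: "closed_face A {v} \<subseteq> ?H F \<longleftrightarrow> v \<in> F" if "v \<in> Q" "F facet_of Q" for v F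
    using facet_form_lift[OF that(2,1)] facet_form[OF that(2)]
    by (simp add: closed_face_subset_hyperplane_iff[OF A])
  have "residual_arrangement P = residual"
  proof (intro set_eqI iffI)
    fix p assume "p \<in> residual_arrangement P"
    then obtain \<S> where \<S>: "\<S> \<subseteq> ?H ` ?\<F>" "p \<in> \<Inter>\<S>" "\<forall>F\<in>P. \<not> F \<subseteq> \<Inter>\<S>"
      unfolding residual_arrangement_def arrangement by blast
    then obtain S where S: "S \<subseteq> ?\<F>" "\<S> = ?H ` S" by (auto simp: subset_image_iff)
    have "\<exists>F\<in>S. v \<notin> F" if v: "v extreme_point_of Q" for v
    proof -
      have "closed_face A {v} \<in> P" using v unfolding P by (auto simp: face_of_singleton)
      then obtain F where F: "F \<in> S" "\<not> closed_face A {v} \<subseteq> ?H F" using \<S>(3) S(2) by blast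
      have "v \<in> Q" using v by (simp add: extreme_point_of_def)
      then show ?thesis using F S(1) vertex_in_H by blast
    qed
    moreover have "\<forall>F\<in>S. \<forall>u\<in>line_of p. lform (c F) u = 0"
      using \<S>(2) S line_in_H by blast
    ultimately show "p \<in> residual"
      using S(1) unfolding residual_def mem_Collect_eq by (intro exI[of _ S]) simp
  next
    fix p assume "p \<in> residual"
    then obtain S where S: "S \<subseteq> ?\<F>" "\<forall>F\<in>S. \<forall>u\<in>line_of p. lform (c F) u = 0"
      "\<forall>v. v extreme_point_of Q \<longrightarrow> (\<exists>F\<in>S. v \<notin> F)"
      unfolding residual_def by blast
    have "p \<in> \<Inter>(?H ` S)" using S(1,2) line_in_H by blast
    moreover have "\<not> K \<subseteq> \<Inter>(?H ` S)" if KP: "K \<in> P" for K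
    proof
      assume K: "K \<subseteq> \<Inter>(?H ` S)"
      obtain G where G: "K = closed_face A G" "G face_of Q" "G \<noteq> {}" using KP unfolding P by blast
      obtain v where v: "v extreme_point_of Q" "v \<in> G"
        using exists_extreme_point_of_face[OF Q G(2,3)] by blast
      then obtain F where F: "F \<in> S" "v \<notin> F" using S(3) by blast
      have "closed_face A G \<subseteq> ?H F" using K G(1) F(1) by blast
      then have "cone_lift A v \<in> cone_span A F"
        using v(2) by (auto simp: closed_face_subset_hyperplane_iff[OF A])
      moreover have "v \<in> Q" using v by (simp add: extreme_point_of_def)
      ultimately show False
        using F S(1) facet_form facet_form_lift by blast
    qed
    moreover have "?H ` S \<subseteq> hyperplane_arrangement P" using S(1) unfolding arrangement by blast
    ultimately show "p \<in> residual_arrangement P"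
      unfolding residual_arrangement_def by blast
  qed
  moreover have "int (card (facets P)) - int CARD('n) = int excess"
    unfolding card_facets_P card_facets by simp
  ultimately have "Omega P = residual_sections"
    by (simp add: Omega_def twisted_ideal_sheaf_def residual_sections_def)
  then show ?thesis
    using dim_residual_sections card_vertices by simp
qed

end
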